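(* The index set $\{ e: \mathcal{C}_e \text{ has degree of bi-embeddable categoricity } \mathbf{0}''\}$ is $\Pi^0_4$-complete.
   Context: An equivalence structure $\mathcal{A}=(A,E)$ has universe $A\subseteq\omega$ and an equivalence relation $E$ on $A$; it is computable if its atomic diagram is computable. Two structures are bi-embeddable if each embeds into the other. The degree of bi-embeddable categoricity of a computable structure $\mathcal{A}$ is the least Turing degree $\mathbf{d}$ (if it exists) such that for any two computable structures bi-embeddable with $\mathcal{A}$, $\mathbf{d}$ computes embeddings between them in both directions. $(\mathcal{C}_e)_{e\in\omega}$ is the enumeration of partial computable equivalence structures: for the $e$-th partial computable function $\phi_e:\omega\times\omega\to\{0,1\}$, $\mathcal{C}_e$ has universe $\omega$ and $x E^{\mathcal{C}_e} y$ iff $\phi_e(x,y)=1$. A set is $\Pi^0_4$-complete if it is $\Pi^0_4$ and every $\Pi^0_4$ set is many-one reducible to it via a computable function. *)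

theory Defs
  imports Main "HOL-Library.Nat_Bijection"
begin

datatype rf = RZero | RSuc | RFst | RSnd | ROrc | RComp rf rf | RPair rf rf | RRec rf rf | RMu rf

inductive ev :: "nat set \<Rightarrow> rf \<Rightarrow> nat \<Rightarrow> nat \<Rightarrow> bool" for A :: "nat set" where
  ev_zero: "ev A RZero x 0"
| ev_suc: "ev A RSuc x (Suc x)"
| ev_fst: "ev A RFst x (fst (prod_decode x))"
| ev_snd: "ev A RSnd x (snd (prod_decode x))"
| ev_orc: "ev A ROrc x (if x \<in> A then 1 else 0)"
| ev_comp: "ev A g x y \<Longrightarrow> ev A f y z \<Longrightarrow> ev A (RComp f g) x z"
| ev_pair: "ev A f x y \<Longrightarrow> ev A g x z \<Longrightarrow> ev A (RPair f g) x (prod_encode (y, z))"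
| ev_rec0: "ev A f a y \<Longrightarrow> ev A (RRec f g) (prod_encode (0, a)) y"
| ev_recS: "ev A (RRec f g) (prod_encode (n, a)) r \<Longrightarrow>
            ev A g (prod_encode (n, prod_encode (r, a))) y \<Longrightarrow>
            ev A (RRec f g) (prod_encode (Suc n, a)) y"
| ev_mu: "ev A f (prod_encode (n, x)) 0 \<Longrightarrow>
          (\<forall>m<n. \<exists>y. y \<noteq> 0 \<and> ev A f (prod_encode (m, x)) y) \<Longrightarrow>
          ev A (RMu f) x n"

primrec enc :: "rf \<Rightarrow> nat" where
  "enc RZero = prod_encode (0, 0)"
| "enc RSuc = prod_encode (1, 0)"
| "enc RFst = prod_encode (2, 0)"
| "enc RSnd = prod_encode (3, 0)"
| "enc ROrc = prod_encode (4, 0)"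
| "enc (RComp f g) = prod_encode (5, prod_encode (enc f, enc g))"
| "enc (RPair f g) = prod_encode (6, prod_encode (enc f, enc g))"
| "enc (RRec f g) = prod_encode (7, prod_encode (enc f, enc g))"
| "enc (RMu f) = prod_encode (8, enc f)"

definition prog :: "nat \<Rightarrow> rf" where
  "prog e = (if \<exists>c. enc c = e then (THE c. enc c = e) else RZero)"

definition chi :: "nat set \<Rightarrow> nat \<Rightarrow> nat" where
  "chi S x = (if x \<in> S then 1 else 0)"

definition turing_le :: "nat set \<Rightarrow> nat set \<Rightarrow> bool" (infix "\<le>\<^sub>T" 50) where
  "S \<le>\<^sub>T B \<longleftrightarrow> (\<exists>c. \<forall>x. ev B c x (chi S x))"

definition computable_set :: "nat set \<Rightarrow> bool" where
  "computable_set S \<longleftrightarrow> S \<le>\<^sub>T {}"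

definition computable_in :: "nat set \<Rightarrow> (nat \<Rightarrow> nat) \<Rightarrow> bool" where
  "computable_in X f \<longleftrightarrow> (\<exists>c. \<forall>x. ev X c x (f x))"

definition jump :: "nat set \<Rightarrow> nat set" where
  "jump X = {e. \<exists>y. ev X (prog e) e y}"

definition many_one_le :: "nat set \<Rightarrow> nat set \<Rightarrow> bool" (infix "\<le>\<^sub>m" 50) where
  "S \<le>\<^sub>m T \<longleftrightarrow> (\<exists>f. computable_in {} f \<and> (\<forall>x. x \<in> S \<longleftrightarrow> f x \<in> T))"

definition Pi04 :: "nat set \<Rightarrow> bool" where
  "Pi04 S \<longleftrightarrow> (\<exists>R. computable_set R \<and>
     (\<forall>x. x \<in> S \<longleftrightarrow> (\<forall>a. \<exists>b. \<forall>c. \<exists>d.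
        prod_encode (x, prod_encode (a, prod_encode (b, prod_encode (c, d)))) \<in> R)))"

definition Pi04_complete :: "nat set \<Rightarrow> bool" where
  "Pi04_complete S \<longleftrightarrow> Pi04 S \<and> (\<forall>T. Pi04 T \<longrightarrow> T \<le>\<^sub>m S)"

definition computable_eq_struct :: "nat set \<Rightarrow> (nat \<times> nat) set \<Rightarrow> bool" where
  "computable_eq_struct U E \<longleftrightarrow> equiv U E \<and> computable_set U \<and>
     computable_set {prod_encode (x, y) | x y. (x, y) \<in> E}"

definition embedding :: "(nat \<Rightarrow> nat) \<Rightarrow> nat set \<Rightarrow> (nat \<times> nat) set \<Rightarrow> nat set \<Rightarrow> (nat \<times> nat) set \<Rightarrow> bool" where
  "embedding f U1 E1 U2 E2 \<longleftrightarrow> f ` U1 \<subseteq> U2 \<and> inj_on f U1 \<and>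
     (\<forall>x\<in>U1. \<forall>y\<in>U1. (x, y) \<in> E1 \<longleftrightarrow> (f x, f y) \<in> E2)"

definition embeds :: "nat set \<Rightarrow> (nat \<times> nat) set \<Rightarrow> nat set \<Rightarrow> (nat \<times> nat) set \<Rightarrow> bool" where
  "embeds U1 E1 U2 E2 \<longleftrightarrow> (\<exists>f. embedding f U1 E1 U2 E2)"

definition bi_embeddable :: "nat set \<Rightarrow> (nat \<times> nat) set \<Rightarrow> nat set \<Rightarrow> (nat \<times> nat) set \<Rightarrow> bool" where
  "bi_embeddable U1 E1 U2 E2 \<longleftrightarrow> embeds U1 E1 U2 E2 \<and> embeds U2 E2 U1 E1"

definition bec_computes :: "nat set \<Rightarrow> nat set \<Rightarrow> (nat \<times> nat) set \<Rightarrow> bool" where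
  "bec_computes X U E \<longleftrightarrow>
     (\<forall>U1 E1 U2 E2. computable_eq_struct U1 E1 \<and> computable_eq_struct U2 E2 \<and>
        bi_embeddable U1 E1 U E \<and> bi_embeddable U2 E2 U E \<longrightarrow>
        (\<exists>f. computable_in X f \<and> embedding f U1 E1 U2 E2) \<and>
        (\<exists>g. computable_in X g \<and> embedding g U2 E2 U1 E1))"

text \<open>(U, E) has degree of bi-embeddable categoricity deg(X): deg(X) is the least
  Turing degree computing such embeddings (the property is degree-invariant).\<close>
definition has_bec_degree :: "nat set \<Rightarrow> (nat \<times> nat) set \<Rightarrow> nat set \<Rightarrow> bool" where
  "has_bec_degree U E X \<longleftrightarrow> bec_computes X U E \<and> (\<forall>Y. bec_computes Y U E \<longrightarrow> X \<le>\<^sub>T Y)"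

definition C_rel :: "nat \<Rightarrow> (nat \<times> nat) set" where
  "C_rel e = {(x, y). ev {} (prog e) (prod_encode (x, y)) 1}"

definition C_is_comp_eq :: "nat \<Rightarrow> bool" where
  "C_is_comp_eq e \<longleftrightarrow> (\<forall>x y. \<exists>v. ev {} (prog e) (prod_encode (x, y)) v) \<and> equiv UNIV (C_rel e)"

definition zero_double_jump :: "nat set" where
  "zero_double_jump = jump (jump {})"

end

theory Submission
  imports Defs "HOL-Library.Infinite_Set"
begin

text \<open>A computable equivalence structure has degree \<open>0''\<close> iff it has infinitely many infinite classes.
  If it has, then all structures with infinitely many infinite classes are bi-embeddable with it,
  embeddings are found by enumerating infinite classes of the target, which is a \<open>\<Pi>\<^sub>2\<close> property, and
  conversely the infinite classes of a suitable target can be made to describe \<open>0''\<close>. If there are only finitely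
  many infinite classes, then \<open>0'\<close> computes the sizes of the other classes, which suffices to find
  embeddings. Having infinitely many infinite classes is \<open>\<forall>\<exists>\<close> over a \<open>\<Pi>\<^sub>2\<close> property, hence \<open>\<Pi>\<^sub>4\<close>. For hardness,
  a \<open>\<Pi>\<^sub>2\<close> condition on keys \<open>k\<close> is turned into a structure whose class with key \<open>k\<close> is infinite iff \<open>k\<close> satisfies it;
  the witnesses of a \<open>\<Pi>\<^sub>4\<close> statement are put into the keys in a unique way.\<close>

text \<open>With only finitely many infinite classes, \<open>0'\<close> computes all required
  embeddings, so a least degree would be at most \<open>0'\<close>, which does not compute its own
  jump. The algorithms may be non-uniform: an embedding is sought for each pair of structures
  separately, so finitely many values can be hard-wired, in particular on the infinite classes,
  which \<open>0'\<close> cannot recognise. Uniqueness of keys matters because only the number of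
  infinite classes is observed. If one initial segment of witnesses had infinitely many codes, there
  could be infinitely many valid keys of bounded length although some witness is missing. With at
  most one key per length, infinitely many keys force unbounded lengths. The evaluation relation has
  no step counter. Its place in the arithmetical hierarchy is found through finite sets of claims
  that justify each other, coded as numbers; relative to an oracle that is both Sigma and Pi at some
  level, evaluation stays Sigma at that level.\<close>

abbreviation pair :: "nat \<Rightarrow> nat \<Rightarrow> nat" where
  "pair x y \<equiv> prod_encode (x, y)"

abbreviation pfst :: "nat \<Rightarrow> nat" where
  "pfst z \<equiv> fst (prod_decode z)"

abbreviation psnd :: "nat \<Rightarrow> nat" where
  "psnd z \<equiv> snd (prod_decode z)"

section \<open>Relative computability\<close>

inductive_cases ev_zeroE: "ev A RZero x y"
inductive_cases ev_sucE: "ev A RSuc x y"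
inductive_cases ev_fstE: "ev A RFst x y"
inductive_cases ev_sndE: "ev A RSnd x y"
inductive_cases ev_orcE: "ev A ROrc x y"
inductive_cases ev_compE: "ev A (RComp f g) x y"
inductive_cases ev_pairE: "ev A (RPair f g) x y"
inductive_cases ev_recE: "ev A (RRec f g) x y"
inductive_cases ev_muE: "ev A (RMu f) x y"

lemma ev_zero_iff: "ev A RZero x y \<longleftrightarrow> y = 0"
  by (auto elim: ev_zeroE intro: ev.intros)

lemma ev_suc_iff: "ev A RSuc x y \<longleftrightarrow> y = Suc x"
  by (auto elim: ev_sucE intro: ev.intros)

lemma ev_fst_iff: "ev A RFst x y \<longleftrightarrow> y = pfst x"
  by (auto elim: ev_fstE intro: ev.intros)

lemma ev_snd_iff: "ev A RSnd x y \<longleftrightarrow> y = psnd x"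
  by (auto elim: ev_sndE intro: ev.intros)

lemma ev_orc_iff: "ev A ROrc x y \<longleftrightarrow> y = chi A x"
  using ev_orc[of A x] by (auto elim: ev_orcE simp: chi_def)

lemma ev_comp_iff: "ev A (RComp f g) x z \<longleftrightarrow> (\<exists>y. ev A g x y \<and> ev A f y z)"
  by (auto elim: ev_compE intro: ev.intros)

lemma ev_pair_iff: "ev A (RPair f g) x z \<longleftrightarrow> (\<exists>u v. ev A f x u \<and> ev A g x v \<and> z = pair u v)"
  by (auto elim: ev_pairE intro: ev.intros)

lemma ev_rec0_iff: "ev A (RRec f g) (pair 0 a) y \<longleftrightarrow> ev A f a y"
  by (auto elim: ev_recE intro: ev.intros)

lemma ev_recS_iff:
  "ev A (RRec f g) (pair (Suc n) a) y \<longleftrightarrow>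
     (\<exists>r. ev A (RRec f g) (pair n a) r \<and> ev A g (pair n (pair r a)) y)"
proof
  assume "ev A (RRec f g) (pair (Suc n) a) y"
  then show "\<exists>r. ev A (RRec f g) (pair n a) r \<and> ev A g (pair n (pair r a)) y"
    by (cases rule: ev.cases) auto
qed (auto intro: ev.intros)

lemma ev_mu_iff:
  "ev A (RMu f) x n \<longleftrightarrow>
     ev A f (pair n x) 0 \<and> (\<forall>m<n. \<exists>y. y \<noteq> 0 \<and> ev A f (pair m x) y)"
  by (auto elim: ev_muE intro: ev.intros)

lemmas ev_iffs = ev_zero_iff ev_suc_iff ev_fst_iff ev_snd_iff ev_orc_iff ev_comp_iff ev_pair_iff
  ev_rec0_iff ev_recS_iff ev_mu_iff

text \<open>Recursion calls the same program again, so \<open>RRec\<close> needs an inner induction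
  on the recursion argument. For \<open>RMu\<close>, the larger of two distinct results would demand
  a nonzero value at the smaller one, where the value is 0.\<close>

lemma ev_deterministic: "ev A c x y \<Longrightarrow> ev A c x z \<Longrightarrow> y = z"
proof (induction c arbitrary: x y z)
  case (RComp f g)
  then show ?case unfolding ev_comp_iff by blast
next
  case (RPair f g)
  then show ?case unfolding ev_pair_iff by blast
next
  case (RRec f g)
  obtain n a where x: "x = pair n a" by (metis prod_decode_inverse surj_pair)
  have "ev A (RRec f g) (pair n a) y \<Longrightarrow> ev A (RRec f g) (pair n a) z \<Longrightarrow> y = z"
  proof (induction n arbitrary: y z)
    case 0
    then show ?case unfolding ev_rec0_iff by (rule RRec.IH(1))
  next
    case (Suc n)
    then show ?case unfolding ev_recS_iff using RRec.IH(2) by blast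
  qed
  then show ?case using RRec.prems x by blast
next
  case (RMu f)
  have "\<not> y < z" if "ev A (RMu f) x y" "ev A (RMu f) x z" for y z
    using that RMu.IH unfolding ev_mu_iff by blast
  then show ?case using RMu.prems by (meson linorder_neqE_nat)
qed (simp_all add: ev_zero_iff ev_suc_iff ev_fst_iff ev_snd_iff ev_orc_iff)

section \<open>Closure properties of computable functions\<close>

lemma comp_id: "computable_in X (\<lambda>x. x)"
  \<comment> \<open>There is no identity program; unpairing and pairing again serves as one, since
    \<open>prod_encode\<close> is a bijection.\<close>
  unfolding computable_in_def by (rule exI[of _ "RPair RFst RSnd"]) (simp add: ev_iffs)

lemma comp_const: "computable_in X (\<lambda>x. k)"
proof (induction k)
  case 0
  show ?case unfolding computable_in_def by (rule exI[of _ RZero]) (simp add: ev_iffs)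
next
  case (Suc k)
  then obtain c where "\<forall>x. ev X c x k" unfolding computable_in_def by auto
  then show ?case unfolding computable_in_def
    by (intro exI[of _ "RComp RSuc c"]) (auto simp: ev_iffs)
qed

lemma comp_comp:
  assumes "computable_in X f" "computable_in X g"
  shows "computable_in X (\<lambda>x. f (g x))"
proof -
  from assms obtain c d where "\<forall>x. ev X c x (f x)" "\<forall>x. ev X d x (g x)"
    unfolding computable_in_def by auto
  then show ?thesis unfolding computable_in_def
    by (intro exI[of _ "RComp c d"]) (auto simp: ev_iffs)
qed

lemma comp_pair:
  assumes "computable_in X f" "computable_in X g"
  shows "computable_in X (\<lambda>x. pair (f x) (g x))"
proof -
  from assms obtain c d where "\<forall>x. ev X c x (f x)" "\<forall>x. ev X d x (g x)"
    unfolding computable_in_def by auto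
  then show ?thesis unfolding computable_in_def
    by (intro exI[of _ "RPair c d"]) (auto simp: ev_iffs)
qed

lemma comp_pfst0: "computable_in X pfst" and comp_psnd0: "computable_in X psnd"
    and comp_Suc0: "computable_in X Suc" and comp_chi0: "computable_in X (chi X)"
  unfolding computable_in_def
  by (rule exI[of _ RFst], simp add: ev_iffs, rule exI[of _ RSnd], simp add: ev_iffs,
      rule exI[of _ RSuc], simp add: ev_iffs, rule exI[of _ ROrc], simp add: ev_iffs)

lemmas comp_pfst = comp_comp[OF comp_pfst0]
  and comp_psnd = comp_comp[OF comp_psnd0]
  and comp_Suc = comp_comp[OF comp_Suc0]

text \<open>The step program of \<open>RRec\<close> sees \<open>(i, (r, x))\<close>, hence the
  projections in the second hypothesis; the parameter \<open>x\<close> is carried along so that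
  \<open>a\<close>, \<open>G\<close> and \<open>n\<close> may depend on it.\<close>

lemma comp_rec:
  assumes "computable_in X a"
    and "computable_in X (\<lambda>z. G (psnd (psnd z)) (pfst z) (pfst (psnd z)))"
    and "computable_in X n"
  shows "computable_in X (\<lambda>x. rec_nat (a x) (\<lambda>i r. G x i r) (n x))"
proof -
  from assms obtain c d e where c: "\<forall>x. ev X c x (a x)"
    and d: "\<forall>z. ev X d z (G (psnd (psnd z)) (pfst z) (pfst (psnd z)))"
    and e: "\<forall>x. ev X e x (n x)"
    unfolding computable_in_def by auto
  have "ev X (RRec c d) (pair m x) (rec_nat (a x) (\<lambda>i r. G x i r) m)" for m x
  proof (induction m)
    case 0
    show ?case using c by (simp add: ev_iffs)
  next
    case (Suc m)
    have "ev X d (pair m (pair (rec_nat (a x) (\<lambda>i r. G x i r) m) x))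
      (rec_nat (a x) (\<lambda>i r. G x i r) (Suc m))"
      using d[rule_format, of "pair m (pair (rec_nat (a x) (\<lambda>i r. G x i r) m) x)"] by simp
    with Suc show ?case unfolding ev_recS_iff by blast
  qed
  note rec = this
  have "ev X (RComp (RRec c d) (RPair e (RPair RFst RSnd))) x (rec_nat (a x) (\<lambda>i r. G x i r) (n x))" for x
  proof (rule ev.ev_comp)
    have "ev X (RPair RFst RSnd) x x" by (simp add: ev_iffs)
    then show "ev X (RPair e (RPair RFst RSnd)) x (pair (n x) x)" using e by (blast intro: ev.ev_pair)
  qed (rule rec)
  then show ?thesis unfolding computable_in_def by blast
qed

definition dec :: "nat set \<Rightarrow> (nat \<Rightarrow> bool) \<Rightarrow> bool" where
  "dec X P \<longleftrightarrow> computable_in X (\<lambda>x. if P x then 1 else 0)"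

text \<open>Recursion of length 0 or 1, the truth value of \<open>P\<close>: the base is
  \<open>g x\<close>, and a single step overwrites it by \<open>f x\<close>.\<close>

lemma comp_if:
  assumes "dec X P" "computable_in X f" "computable_in X g"
  shows "computable_in X (\<lambda>x. if P x then f x else g x)"
proof -
  have "computable_in X (\<lambda>x. rec_nat (g x) (\<lambda>_ _. f x) (if P x then 1 else 0))"
    by (intro comp_rec assms(1)[unfolded dec_def] assms(3) comp_comp[OF assms(2)] comp_psnd comp_id)
  moreover have "(\<lambda>x. rec_nat (g x) (\<lambda>_ _. f x) (if P x then 1 else 0)) = (\<lambda>x. if P x then f x else g x)"
    by auto
  ultimately show ?thesis by simp
qed

lemma comp_Least:
  assumes "dec X (\<lambda>z. P (pfst z) (psnd z))" and total: "\<And>x. \<exists>y. P x y"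
  shows "computable_in X (\<lambda>x. LEAST y. P x y)"
proof -
  \<comment> \<open>\<open>RMu\<close> searches for a value 0 and puts the candidate before the
    argument, so truth values are flipped and components swapped.\<close>
  have "computable_in X (\<lambda>z. if P (psnd z) (pfst z) then 0 else 1)"
    using comp_comp[OF assms(1)[unfolded dec_def] comp_pair[OF comp_psnd0 comp_pfst0]]
    by (intro comp_if comp_const) (simp add: dec_def)
  then obtain c where c: "\<forall>z. ev X c z (if P (psnd z) (pfst z) then 0 else 1)"
    unfolding computable_in_def by auto
  have "ev X (RMu c) x (LEAST y. P x y)" for x
  proof -
    have "P x (LEAST y. P x y)" using total by (rule LeastI_ex)
    then have "ev X c (pair (LEAST y. P x y) x) 0"
      using c[rule_format, of "pair (LEAST y. P x y) x"] by simp
    moreover have "ev X c (pair m x) 1" if "m < (LEAST y. P x y)" for m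
      using c[rule_format, of "pair m x"] not_less_Least[OF that] by simp
    ultimately show ?thesis unfolding ev_mu_iff by (metis one_neq_zero)
  qed
  then show ?thesis unfolding computable_in_def by blast
qed

lemma dec_subst: "dec X P \<Longrightarrow> computable_in X f \<Longrightarrow> dec X (\<lambda>x. P (f x))"
  unfolding dec_def by (rule comp_comp)

lemma dec_const: "dec X (\<lambda>x. b)"
  unfolding dec_def by (rule comp_const)

lemma dec_not:
  assumes "dec X P"
  shows "dec X (\<lambda>x. \<not> P x)"
proof -
  have "computable_in X (\<lambda>x. if P x then 0 else 1)" by (intro comp_if assms comp_const)
  moreover have "(\<lambda>x. if P x then 0 else 1) = (\<lambda>x. if \<not> P x then 1 else (0::nat))" by auto
  ultimately show ?thesis unfolding dec_def by simp
qed

lemma dec_conj: "dec X P \<Longrightarrow> dec X Q \<Longrightarrow> dec X (\<lambda>x. P x \<and> Q x)"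
proof -
  assume P: "dec X P" and Q: "dec X Q"
  have "computable_in X (\<lambda>x. if P x then (if Q x then 1 else 0) else 0)"
    by (intro comp_if P Q comp_const)
  moreover have "(\<lambda>x. if P x then (if Q x then 1 else 0) else 0) = (\<lambda>x. if P x \<and> Q x then 1 else (0::nat))"
    by auto
  ultimately show ?thesis unfolding dec_def by simp
qed

lemma dec_disj: "dec X P \<Longrightarrow> dec X Q \<Longrightarrow> dec X (\<lambda>x. P x \<or> Q x)"
  using dec_not[OF dec_conj[of X "\<lambda>x. \<not> P x" "\<lambda>x. \<not> Q x"]] by (simp add: dec_not)

lemma comp_add:
  assumes "computable_in X f" "computable_in X g"
  shows "computable_in X (\<lambda>x. f x + g x)"
proof -
  have "rec_nat a (\<lambda>i r. Suc r) n = a + n" for a n by (induction n) auto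
  then show ?thesis
    using comp_rec[OF assms(1) _ assms(2), of "\<lambda>x i r. Suc r"]
    by (simp add: comp_Suc comp_pfst comp_psnd comp_id)
qed

lemma comp_mult:
  assumes "computable_in X f" "computable_in X g"
  shows "computable_in X (\<lambda>x. f x * g x)"
proof -
  have "rec_nat 0 (\<lambda>i r. r + a) n = a * n" for a n by (induction n) auto
  moreover have "computable_in X (\<lambda>x. rec_nat 0 (\<lambda>i r. r + f x) (g x))"
    by (intro comp_rec comp_const comp_add comp_pfst comp_psnd comp_id assms comp_comp[OF assms(1)])
  ultimately show ?thesis by simp
qed

lemma comp_pow2:
  assumes "computable_in X f"
  shows "computable_in X (\<lambda>x. 2 ^ f x)"
proof -
  have "rec_nat 1 (\<lambda>i r. r + r) n = (2 :: nat) ^ n" for n :: nat by (induction n) auto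
  moreover have "computable_in X (\<lambda>x. rec_nat 1 (\<lambda>i r. r + r) (f x))"
    by (intro comp_rec comp_const comp_add comp_pfst comp_psnd comp_id assms)
  ultimately show ?thesis by simp
qed

lemma comp_diff:
  assumes "computable_in X f" "computable_in X g"
  shows "computable_in X (\<lambda>x. f x - g x)"
proof -
  have p: "computable_in X (\<lambda>x. h x - 1)" if "computable_in X h" for h
  proof -
    have "rec_nat 0 (\<lambda>i r. i) n = n - 1" for n by (induction n) auto
    moreover have "computable_in X (\<lambda>x. rec_nat 0 (\<lambda>i r. i) (h x))"
      by (intro comp_rec comp_const comp_pfst comp_id that)
    ultimately show ?thesis by simp
  qed
  have "rec_nat a (\<lambda>i r. r - 1) n = a - n" for a n by (induction n) auto
  moreover have "computable_in X (\<lambda>x. rec_nat (f x) (\<lambda>i r. r - 1) (g x))"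
    by (intro comp_rec p comp_pfst comp_psnd comp_id assms)
  ultimately show ?thesis by simp
qed

lemma dec_le:
  assumes "computable_in X f" "computable_in X g"
  shows "dec X (\<lambda>x. f x \<le> g x)"
proof -
  have "computable_in X (\<lambda>x. 1 - (f x - g x))"
    by (intro comp_diff comp_const assms)
  moreover have "(\<lambda>x. 1 - (f x - g x)) = (\<lambda>x. if f x \<le> g x then 1 else 0)" by auto
  ultimately show ?thesis unfolding dec_def by simp
qed

lemma dec_less:
  assumes "computable_in X f" "computable_in X g"
  shows "dec X (\<lambda>x. f x < g x)"
  using dec_le[OF comp_Suc[OF assms(1)] assms(2)] by (simp add: Suc_le_eq)

lemma dec_eq:
  assumes "computable_in X f" "computable_in X g"
  shows "dec X (\<lambda>x. f x = g x)"
  using dec_conj[OF dec_le[OF assms] dec_le[OF assms(2,1)]] by (simp add: order_eq_iff)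

lemma dec_ball:
  assumes n: "computable_in X n" and P: "dec X (\<lambda>z. P (pfst z) (psnd z))"
  shows "dec X (\<lambda>x. \<forall>i<n x. P x i)"
proof -
  \<comment> \<open>The disjunct \<open>n x \<le> i\<close> makes the search total; it stops below
    \<open>n x\<close> exactly if there is a counterexample.\<close>
  define L where "L = (\<lambda>x. LEAST i. n x \<le> i \<or> \<not> P x i)"
  have "computable_in X L" unfolding L_def
    by (intro comp_Least dec_disj dec_not P dec_le comp_comp[OF n] comp_pfst comp_psnd comp_id)
      auto
  then have "dec X (\<lambda>x. n x \<le> L x)" by (intro dec_le n)
  moreover have "n x \<le> L x \<longleftrightarrow> (\<forall>i<n x. P x i)" for x
  proof
    show "n x \<le> L x \<Longrightarrow> \<forall>i<n x. P x i"
      unfolding L_def using not_less_Least by (metis (mono_tags, lifting) less_le_trans)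
    have "n x \<le> L x \<or> \<not> P x (L x)"
      unfolding L_def by (rule LeastI[of _ "n x"]) simp
    then show "n x \<le> L x" if "\<forall>i<n x. P x i" using that not_less by blast
  qed
  ultimately show ?thesis by simp
qed

lemma dec_bex:
  assumes "computable_in X n" "dec X (\<lambda>z. P (pfst z) (psnd z))"
  shows "dec X (\<lambda>x. \<exists>i<n x. P x i)"
  using dec_not[OF dec_ball[OF assms(1) dec_not[OF assms(2)]]] by simp

lemma dec_oracle: "computable_in X f \<Longrightarrow> dec X (\<lambda>x. f x \<in> X)"
  unfolding dec_def using comp_comp[OF comp_chi0] by (simp add: chi_def)

lemma turing_le_iff_dec: "S \<le>\<^sub>T X \<longleftrightarrow> dec X (\<lambda>x. x \<in> S)"
  by (simp add: turing_le_def dec_def computable_in_def chi_def)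

lemma computable_set_iff_dec: "computable_set S \<longleftrightarrow> dec {} (\<lambda>x. x \<in> S)"
  by (simp add: computable_set_def turing_le_iff_dec)

text \<open>Each oracle query in a program is replaced by the program \<open>d\<close> that decides
  \<open>Y\<close> from \<open>X\<close>; the evaluation rules carry over one by one.\<close>

lemma comp_oracle_mono:
  assumes "Y \<le>\<^sub>T X" "computable_in Y f"
  shows "computable_in X f"
proof -
  obtain d where d: "\<And>x. ev X d x (chi Y x)" using assms(1) by (auto simp: turing_le_def)
  define tr where "tr = rec_rf RZero RSuc RFst RSnd d (\<lambda>_ _. RComp) (\<lambda>_ _. RPair) (\<lambda>_ _. RRec) (\<lambda>_. RMu)"
  have tr: "tr RZero = RZero" "tr RSuc = RSuc" "tr RFst = RFst" "tr RSnd = RSnd" "tr ROrc = d"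
    "tr (RComp f g) = RComp (tr f) (tr g)" "tr (RPair f g) = RPair (tr f) (tr g)"
    "tr (RRec f g) = RRec (tr f) (tr g)" "tr (RMu f) = RMu (tr f)" for f g
    by (simp_all add: tr_def)
  have "ev Y c x y \<Longrightarrow> ev X (tr c) x y" for c x y
  proof (induction rule: ev.induct)
    case (ev_orc x)
    then show ?case using d[of x] by (simp only: tr chi_def)
  next
    case (ev_mu f n x)
    then show ?case unfolding tr by (intro ev.ev_mu) blast+
  qed (unfold tr; rule ev.intros; assumption)+
  then show ?thesis using assms(2) unfolding computable_in_def by blast
qed

lemma dec_oracle_mono: "Y \<le>\<^sub>T X \<Longrightarrow> dec Y P \<Longrightarrow> dec X P"
  unfolding dec_def by (rule comp_oracle_mono)

lemma empty_turing_le: "{} \<le>\<^sub>T X"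
  unfolding turing_le_iff_dec by (simp add: dec_const)

lemmas comp_of_empty = comp_oracle_mono[OF empty_turing_le]
lemmas dec_of_empty = dec_oracle_mono[OF empty_turing_le]

text \<open>The values on \<open>F\<close> are hard-wired one at a time, so \<open>g\<close> may be
  any function at all; this is how a finite part of a noncomputable embedding enters an
  algorithm.\<close>

lemma comp_fun_upd_finite:
  assumes "computable_in X f" "finite F"
  shows "computable_in X (\<lambda>x. if x \<in> F then g x else f x)"
  using assms(2)
proof (induction F rule: finite_induct)
  case empty
  show ?case using assms(1) by simp
next
  case (insert a F)
  have "computable_in X (\<lambda>x. if x = a then g a else if x \<in> F then g x else f x)"
    by (intro comp_if dec_eq comp_id comp_const insert.IH)
  moreover have "(\<lambda>x. if x = a then g a else if x \<in> F then g x else f x) =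
      (\<lambda>x. if x \<in> insert a F then g x else f x)"
    by auto
  ultimately show ?case by simp
qed

lemma dec_finite:
  assumes "finite F"
  shows "dec X (\<lambda>x. x \<in> F)"
  unfolding dec_def by (rule comp_fun_upd_finite[OF comp_const assms])

lemma dec_mem_set_decode:
  assumes "computable_in X f" "computable_in X g"
  shows "dec X (\<lambda>x. f x \<in> set_decode (g x))"
proof -
  \<comment> \<open>Bit \<open>x\<close> of \<open>n\<close> is 1 iff the quotient by
    \<open>2 ^ x\<close> is odd; the division is replaced by bounded quantifiers over half the
    quotient and the remainder.\<close>
  have *: "x \<in> set_decode n \<longleftrightarrow> (\<exists>q<Suc n. \<exists>r<2 ^ x. n = (2 * q + 1) * 2 ^ x + r)" for x n :: nat
  proof
    assume "x \<in> set_decode n"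
    then have "odd (n div 2 ^ x)" by (simp add: set_decode_def)
    then obtain q where q: "n div 2 ^ x = 2 * q + 1" by (auto elim: oddE)
    have "n = (n div 2 ^ x) * 2 ^ x + n mod 2 ^ x" by (rule div_mult_mod_eq[symmetric])
    then have "n = (2 * q + 1) * 2 ^ x + n mod 2 ^ x" unfolding q .
    moreover have "q < Suc n" using q div_le_dividend[of n "2 ^ x"] by linarith
    ultimately show "\<exists>q<Suc n. \<exists>r<2 ^ x. n = (2 * q + 1) * 2 ^ x + r"
      by (meson mod_less_divisor zero_less_numeral zero_less_power)
  next
    assume "\<exists>q<Suc n. \<exists>r<2 ^ x. n = (2 * q + 1) * 2 ^ x + r"
    then obtain q r where "r < 2 ^ x" "n = (2 * q + 1) * 2 ^ x + r" by blast
    then have "n div 2 ^ x = 2 * q + 1" by (intro div_nat_eqI) (simp_all add: algebra_simps)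
    then show "x \<in> set_decode n" by (simp add: set_decode_def)
  qed
  show ?thesis unfolding *
    by (intro dec_bex dec_eq comp_add comp_mult comp_pow2 comp_const comp_Suc
        comp_comp[OF assms(1)] comp_comp[OF assms(2)] assms comp_pfst comp_psnd comp_id)
qed

lemmas dec_intros = dec_const dec_conj dec_disj dec_not dec_ball dec_bex dec_eq dec_le dec_less
  dec_mem_set_decode
lemmas comp_intros = comp_id comp_const comp_pfst comp_psnd comp_Suc comp_pair comp_add comp_diff
  comp_mult comp_pow2

section \<open>Program codes and the jump\<close>

lemma enc_inject: "enc c = enc d \<Longrightarrow> c = d"
proof (induction c arbitrary: d)
qed (case_tac d; force)+

lemma prog_enc: "prog (enc c) = c"
  unfolding prog_def using enc_inject by auto

text \<open>The s-m-n theorem: \<open>x\<close> is hard-wired as the numeral program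
  \<open>const x\<close>, whose code is primitive recursive in \<open>x\<close>.\<close>

lemma smn:
  obtains h where "computable_in {} h"
    "\<And>A x y v. ev A (prog (h x)) y v \<longleftrightarrow> ev A s (pair x y) v"
proof -
  define const where "const = rec_nat RZero (\<lambda>_ r. RComp RSuc r)"
  have const: "ev A (const x) y v \<longleftrightarrow> v = x" for A x y v
    by (induction x arbitrary: v) (auto simp: const_def ev_iffs)
  define h where "h x = enc (RComp s (RPair (const x) (RPair RFst RSnd)))" for x
  have enc_const: "enc (const x) = rec_nat (enc RZero) (\<lambda>_ r. pair 5 (pair (enc RSuc) r)) x" for x
    by (induction x) (auto simp: const_def)
  have "computable_in {} h"
    unfolding h_def enc.simps(6,7) enc_const by (intro comp_rec comp_intros)
  moreover have "ev A (prog (h x)) y v \<longleftrightarrow> ev A s (pair x y) v" for A x y v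
    unfolding h_def prog_enc by (simp add: ev_comp_iff ev_pair_iff const ev_fst_iff ev_snd_iff)
  ultimately show ?thesis by (rule that)
qed

text \<open>Diagonalisation: a decision procedure for the jump yields \<open>d\<close> that halts
  exactly outside the jump, which is contradictory at its own code. The search index is discarded by
  \<open>RSnd\<close>, so \<open>RMu\<close> stops at 0 or never.\<close>

lemma not_jump_turing_le: "\<not> jump X \<le>\<^sub>T X"
proof
  assume "jump X \<le>\<^sub>T X"
  then obtain c where c: "\<And>x. ev X c x (chi (jump X) x)" by (auto simp: turing_le_def)
  define d where "d = RMu (RComp c RSnd)"
  have "ev X (RComp c RSnd) (pair m x) v \<longleftrightarrow> v = chi (jump X) x" for m x v
    using c ev_deterministic by (auto simp: ev_comp_iff ev_snd_iff)
  then have "(\<exists>y. ev X d x y) \<longleftrightarrow> x \<notin> jump X" for x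
    by (auto simp: d_def ev_mu_iff chi_def)
  moreover have "enc d \<in> jump X \<longleftrightarrow> (\<exists>y. ev X d (enc d) y)"
    by (simp add: jump_def prog_enc)
  ultimately show False by blast
qed

lemma dec_jump_ex:
  assumes "dec X (\<lambda>z. P (pfst z) (psnd z))"
  shows "dec (jump X) (\<lambda>x. \<exists>y. P x y)"
proof -
  have "dec X (\<lambda>z. P (psnd z) (pfst z))"
    using dec_subst[OF assms comp_pair[OF comp_psnd0 comp_pfst0]] by simp
  then have "computable_in X (\<lambda>z. if P (psnd z) (pfst z) then 0 else 1)"
    by (intro comp_if comp_const)
  then obtain c where "\<And>z. ev X c z (if P (psnd z) (pfst z) then 0 else 1)"
    unfolding computable_in_def by auto
  then have c: "ev X c z v \<longleftrightarrow> v = (if P (psnd z) (pfst z) then 0 else 1)" for z v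
    using ev_deterministic by blast
  have mu: "(\<exists>v. ev X (RMu c) x v) \<longleftrightarrow> (\<exists>y. P x y)" for x
  proof
    assume "\<exists>y. P x y"
    then have "P x (LEAST y. P x y)" by (rule LeastI_ex)
    then show "\<exists>v. ev X (RMu c) x v"
      by (intro exI[of _ "LEAST y. P x y"]) (auto simp: ev_mu_iff c dest: not_less_Least)
  qed (auto simp: ev_mu_iff c split: if_splits)
  \<comment> \<open>The jump asks a program about its own code; discarding that input with
    \<open>RFst\<close> leaves the search for \<open>x\<close>.\<close>
  obtain h where h: "computable_in {} h"
    "\<And>A x y v. ev A (prog (h x)) y v \<longleftrightarrow> ev A (RComp (RMu c) RFst) (pair x y) v"
    by (rule smn[of "RComp (RMu c) RFst"]) blast
  have "ev X (prog (h x)) (h x) = ev X (RMu c) x" for x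
    by (rule ext) (simp add: h(2) ev_comp_iff ev_fst_iff)
  then have "h x \<in> jump X \<longleftrightarrow> (\<exists>y. P x y)" for x
    by (simp add: jump_def mu)
  then show ?thesis
    using dec_oracle[OF comp_of_empty[OF h(1)], of "jump X"] by simp
qed

section \<open>The arithmetical hierarchy\<close>

text \<open>The matrix \<open>S\<close> must have its complement in the previous level, that is, be
  Pi there, so one recursion yields both hierarchies.\<close>

primrec Sig :: "nat \<Rightarrow> (nat \<Rightarrow> bool) \<Rightarrow> bool" where
  "Sig 0 = dec {}"
| "Sig (Suc n) = (\<lambda>P. \<exists>S. Sig n (\<lambda>z. \<not> S z) \<and> P = (\<lambda>x. \<exists>y. S (pair x y)))"

abbreviation Pi :: "nat \<Rightarrow> (nat \<Rightarrow> bool) \<Rightarrow> bool" where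
  "Pi n P \<equiv> Sig n (\<lambda>x. \<not> P x)"

text \<open>A number \<open>w\<close> codes the infinite list \<open>nthc w 0, nthc w 1, \<dots>\<close>; requiring \<open>tlc w n = 0\<close>
  makes the code of a list of length \<open>n\<close> unique.\<close>

definition tlc :: "nat \<Rightarrow> nat \<Rightarrow> nat" where
  "tlc w i = rec_nat w (\<lambda>_ r. psnd r) i"

definition nthc :: "nat \<Rightarrow> nat \<Rightarrow> nat" where
  "nthc w i = pfst (tlc w i)"

lemma tlc_0 [simp]: "tlc w 0 = w"
  by (simp add: tlc_def)

lemma tlc_Suc [simp]: "tlc w (Suc i) = tlc (psnd w) i"
proof -
  have "tlc w (Suc i) = psnd (tlc w i)" for w i by (simp add: tlc_def)
  then show ?thesis by (induction i) auto
qed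

lemma nthc_0 [simp]: "nthc w 0 = pfst w" and nthc_Suc [simp]: "nthc w (Suc i) = nthc (psnd w) i"
  by (simp_all add: nthc_def)

lemma comp_tlc:
  assumes "computable_in X f" "computable_in X g"
  shows "computable_in X (\<lambda>x. tlc (f x) (g x))"
  unfolding tlc_def by (intro comp_rec comp_psnd comp_pfst comp_id assms)

lemma comp_nthc:
  assumes "computable_in X f" "computable_in X g"
  shows "computable_in X (\<lambda>x. nthc (f x) (g x))"
  unfolding nthc_def by (intro comp_pfst comp_tlc assms)

lemma nthc_exists: "\<exists>w. tlc w n = 0 \<and> (\<forall>i<n. nthc w i = F i)"
proof (induction n arbitrary: F)
  case (Suc n)
  from Suc[of "\<lambda>i. F (Suc i)"] obtain w where "tlc w n = 0" "\<forall>i<n. nthc w i = F (Suc i)" by blast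
  then have "tlc (pair (F 0) w) (Suc n) = 0 \<and> (\<forall>i<Suc n. nthc (pair (F 0) w) i = F i)"
    by (auto simp: less_Suc_eq_0_disj)
  then show ?case by blast
qed auto

lemma nthc_unique:
  "tlc w n = 0 \<Longrightarrow> tlc v n = 0 \<Longrightarrow> (\<And>i. i < n \<Longrightarrow> nthc w i = nthc v i) \<Longrightarrow> w = v"
proof (induction n arbitrary: w v)
  case (Suc n)
  have "psnd w = psnd v"
  proof (rule Suc.IH)
    show "nthc (psnd w) i = nthc (psnd v) i" if "i < n" for i
      using Suc.prems(3)[of "Suc i"] that by simp
  qed (use Suc.prems(1,2) in simp_all)
  moreover have "pfst w = pfst v" using Suc.prems(3)[of 0] by simp
  ultimately show ?case by (metis prod.collapse prod_decode_inverse)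
qed simp

text \<open>Collection: finitely many witnesses are packed into one number, which lets a bounded
  universal quantifier pass an existential one.\<close>

lemma bounded_choice_nthc: "(\<forall>i<n. \<exists>y. S i y) \<longleftrightarrow> (\<exists>w. \<forall>i<n. S i (nthc w i))"
proof
  assume "\<forall>i<n. \<exists>y. S i y"
  then obtain F where "\<forall>i<n. S i (F i)" by metis
  then show "\<exists>w. \<forall>i<n. S i (nthc w i)" using nthc_exists[of n F] by metis
qed blast

lemma Sig_SucI:
  "Sig n (\<lambda>z. \<not> S (pfst z) (psnd z)) \<Longrightarrow> Sig (Suc n) (\<lambda>x. \<exists>y. S x y)"
  unfolding Sig.simps by (intro exI[of _ "\<lambda>z. S (pfst z) (psnd z)"]) simp

lemma Sig_SucE:
  assumes "Sig (Suc n) P"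
  obtains S where "Sig n (\<lambda>z. \<not> S z)" "P = (\<lambda>x. \<exists>y. S (pair x y))"
  using assms by auto

declare Sig.simps(2) [simp del]

lemma Sig_subst: "Sig n P \<Longrightarrow> computable_in {} h \<Longrightarrow> Sig n (\<lambda>x. P (h x))"
proof (induction n arbitrary: P h)
  case 0
  then show ?case by (simp add: dec_subst)
next
  case (Suc n)
  from Suc.prems(1) obtain S where S: "Sig n (\<lambda>z. \<not> S z)" "P = (\<lambda>x. \<exists>y. S (pair x y))"
    by (rule Sig_SucE)
  have "Sig n (\<lambda>z. \<not> S (pair (h (pfst z)) (psnd z)))"
    by (intro Suc.IH[OF S(1)] comp_pair comp_comp[OF Suc.prems(2)] comp_intros)
  then show ?case unfolding S(2) by (rule Sig_SucI)
qed

lemma Sig_of_Pi: "Pi n P \<Longrightarrow> Sig (Suc n) P"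
  using Sig_SucI[of n "\<lambda>x y. P x"] Sig_subst[OF _ comp_pfst0, of n "\<lambda>x. \<not> P x"] by simp

lemma Sig_dec: "dec {} P \<Longrightarrow> Sig n P"
proof (induction n arbitrary: P)
  case (Suc n)
  show ?case by (intro Sig_of_Pi Suc.IH dec_not Suc.prems)
qed simp

lemma Sig_Suc: "Sig n P \<Longrightarrow> Sig (Suc n) P"
proof (induction n arbitrary: P)
  case 0
  then show ?case by (intro Sig_dec) simp
next
  case (Suc n)
  from Suc.prems obtain S where S: "Sig n (\<lambda>z. \<not> S z)" "P = (\<lambda>x. \<exists>y. S (pair x y))"
    by (rule Sig_SucE)
  show ?case unfolding S(2) using Suc.IH[OF S(1)] by (intro Sig_SucI) simp
qed

text \<open>A simultaneous induction is needed because passing to the matrix complements it: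
  conjunction at one level uses disjunction at the level below, and bounded \<forall> uses bounded
  \<exists>.\<close>

lemma Sig_closure:
  "(\<forall>P Q. Sig n P \<longrightarrow> Sig n Q \<longrightarrow> Sig n (\<lambda>x. P x \<and> Q x)) \<and>
   (\<forall>P Q. Sig n P \<longrightarrow> Sig n Q \<longrightarrow> Sig n (\<lambda>x. P x \<or> Q x)) \<and>
   (\<forall>P h. computable_in {} h \<longrightarrow> Sig n (\<lambda>z. P (pfst z) (psnd z)) \<longrightarrow> Sig n (\<lambda>x. \<forall>i<h x. P x i)) \<and>
   (\<forall>P h. computable_in {} h \<longrightarrow> Sig n (\<lambda>z. P (pfst z) (psnd z)) \<longrightarrow> Sig n (\<lambda>x. \<exists>i<h x. P x i))"
proof (induction n)
  case 0
  show ?case unfolding Sig.simps by (intro conjI allI impI dec_conj dec_disj dec_ball dec_bex)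
next
  case (Suc n)
  have conj: "Sig n (\<lambda>x. P x \<and> Q x)" if "Sig n P" "Sig n Q" for P Q
    using Suc.IH that by blast
  have disj: "Sig n (\<lambda>x. P x \<or> Q x)" if "Sig n P" "Sig n Q" for P Q
    using Suc.IH that by blast
  have bex: "Sig n (\<lambda>x. \<exists>i<h x. P x i)"
    if "computable_in {} h" "Sig n (\<lambda>z. P (pfst z) (psnd z))" for P h
    using Suc.IH that by blast
  show ?case
  proof (intro conjI allI impI)
    fix P Q assume P: "Sig (Suc n) P" and Q: "Sig (Suc n) Q"
    from P obtain S where S: "Sig n (\<lambda>z. \<not> S z)" "P = (\<lambda>x. \<exists>y. S (pair x y))"
      by (rule Sig_SucE)
    from Q obtain T where T: "Sig n (\<lambda>z. \<not> T z)" "Q = (\<lambda>x. \<exists>y. T (pair x y))"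
      by (rule Sig_SucE)
    have "Sig (Suc n) (\<lambda>x. \<exists>y. S (pair x y) \<or> T (pair x y))"
      using conj[OF S(1) T(1)] by (intro Sig_SucI) simp
    moreover have "(\<lambda>x. \<exists>y. S (pair x y) \<or> T (pair x y)) = (\<lambda>x. P x \<or> Q x)"
      unfolding S(2) T(2) by auto
    ultimately show "Sig (Suc n) (\<lambda>x. P x \<or> Q x)" by simp
    have "Sig n (\<lambda>z. \<not> S (pair (pfst z) (pfst (psnd z))) \<or> \<not> T (pair (pfst z) (psnd (psnd z))))"
      by (intro disj Sig_subst[OF S(1)] Sig_subst[OF T(1)] comp_intros)
    then have "Sig (Suc n) (\<lambda>x. \<exists>y. S (pair x (pfst y)) \<and> T (pair x (psnd y)))"
      by (intro Sig_SucI) simp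
    moreover have "(\<lambda>x. \<exists>y. S (pair x (pfst y)) \<and> T (pair x (psnd y))) = (\<lambda>x. P x \<and> Q x)"
      unfolding S(2) T(2) by (metis fst_conv prod_encode_inverse snd_conv)
    ultimately show "Sig (Suc n) (\<lambda>x. P x \<and> Q x)" by simp
  next
    fix P and h :: "nat \<Rightarrow> nat"
    assume h: "computable_in {} h" and Q: "Sig (Suc n) (\<lambda>z. P (pfst z) (psnd z))"
    from Q obtain S where S: "Sig n (\<lambda>z. \<not> S z)"
      and "(\<lambda>z. P (pfst z) (psnd z)) = (\<lambda>x. \<exists>y. S (pair x y))"
      by (rule Sig_SucE)
    then have P: "P x i \<longleftrightarrow> (\<exists>y. S (pair (pair x i) y))" for x i
      by (metis fst_conv prod_encode_inverse snd_conv)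
    have "Sig n (\<lambda>z. \<exists>i<h (pfst z). \<not> S (pair (pair (pfst z) i) (nthc (psnd z) i)))"
      by (intro bex Sig_subst[OF S] comp_nthc comp_intros comp_comp[OF h])
    then have "Sig (Suc n) (\<lambda>x. \<exists>w. \<forall>i<h x. S (pair (pair x i) (nthc w i)))"
      by (intro Sig_SucI) simp
    then show "Sig (Suc n) (\<lambda>x. \<forall>i<h x. P x i)"
      unfolding P bounded_choice_nthc .
    have "Sig n (\<lambda>z. \<not> pfst (psnd z) < h (pfst z) \<or>
        \<not> S (pair (pair (pfst z) (pfst (psnd z))) (psnd (psnd z))))"
      by (intro disj Sig_subst[OF S] Sig_dec dec_not dec_less comp_comp[OF h] comp_intros)
    then have "Sig (Suc n) (\<lambda>x. \<exists>y. pfst y < h x \<and> S (pair (pair x (pfst y)) (psnd y)))"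
      by (intro Sig_SucI) (simp add: de_Morgan_conj)
    moreover have "(\<lambda>x. \<exists>y. pfst y < h x \<and> S (pair (pair x (pfst y)) (psnd y))) = (\<lambda>x. \<exists>i<h x. P x i)"
      unfolding P by (metis fst_conv prod_encode_inverse snd_conv)
    ultimately show "Sig (Suc n) (\<lambda>x. \<exists>i<h x. P x i)" by simp
  qed
qed

lemma Sig_conj: "Sig n P \<Longrightarrow> Sig n Q \<Longrightarrow> Sig n (\<lambda>x. P x \<and> Q x)"
  and Sig_disj: "Sig n P \<Longrightarrow> Sig n Q \<Longrightarrow> Sig n (\<lambda>x. P x \<or> Q x)"
  and Sig_ball: "computable_in {} h \<Longrightarrow> Sig n (\<lambda>z. R (pfst z) (psnd z)) \<Longrightarrow> Sig n (\<lambda>x. \<forall>i<h x. R x i)"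
  and Sig_bex: "computable_in {} h \<Longrightarrow> Sig n (\<lambda>z. R (pfst z) (psnd z)) \<Longrightarrow> Sig n (\<lambda>x. \<exists>i<h x. R x i)"
  using Sig_closure[of n] by blast+

lemma Pi_conj: "Pi n P \<Longrightarrow> Pi n Q \<Longrightarrow> Pi n (\<lambda>x. P x \<and> Q x)"
  unfolding de_Morgan_conj by (rule Sig_disj)

lemma Pi_disj: "Pi n P \<Longrightarrow> Pi n Q \<Longrightarrow> Pi n (\<lambda>x. P x \<or> Q x)"
  unfolding de_Morgan_disj by (rule Sig_conj)

lemma Pi_imp: "Sig n P \<Longrightarrow> Pi n Q \<Longrightarrow> Pi n (\<lambda>x. P x \<longrightarrow> Q x)"
  unfolding not_imp by (rule Sig_conj)

lemma Pi_ball: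
  "computable_in {} h \<Longrightarrow> Pi n (\<lambda>z. R (pfst z) (psnd z)) \<Longrightarrow> Pi n (\<lambda>x. \<forall>i<h x. R x i)"
  using Sig_bex[of h n "\<lambda>x i. \<not> R x i"] by simp

lemma Pi_dec: "dec {} P \<Longrightarrow> Pi n P"
  by (intro Sig_dec dec_not)

lemma Pi_not: "Sig n P \<Longrightarrow> Pi n (\<lambda>x. \<not> P x)"
  by simp

lemma Pi_Suc: "Pi n P \<Longrightarrow> Pi (Suc n) P"
  by (rule Sig_Suc)

lemma Pi_of_Sig: "Sig n P \<Longrightarrow> Pi (Suc n) P"
  using Sig_of_Pi[of n "\<lambda>x. \<not> P x"] by simp

lemma Sig_ex:
  assumes "Sig (Suc n) (\<lambda>z. P (pfst z) (psnd z))"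
  shows "Sig (Suc n) (\<lambda>x. \<exists>y. P x y)"
proof -
  from assms obtain S where S: "Sig n (\<lambda>z. \<not> S z)"
    and "(\<lambda>z. P (pfst z) (psnd z)) = (\<lambda>x. \<exists>y. S (pair x y))"
    by (rule Sig_SucE)
  then have P: "P x i \<longleftrightarrow> (\<exists>y. S (pair (pair x i) y))" for x i
    by (metis fst_conv prod_encode_inverse snd_conv)
  have "Sig n (\<lambda>z. \<not> S (pair (pair (pfst z) (pfst (psnd z))) (psnd (psnd z))))"
    by (intro Sig_subst[OF S] comp_intros)
  then have "Sig (Suc n) (\<lambda>x. \<exists>y. S (pair (pair x (pfst y)) (psnd y)))"
    by (rule Sig_SucI)
  moreover have "(\<lambda>x. \<exists>y. S (pair (pair x (pfst y)) (psnd y))) = (\<lambda>x. \<exists>y. P x y)"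
    unfolding P by (metis fst_conv prod_encode_inverse snd_conv)
  ultimately show ?thesis by simp
qed

lemma Pi_all: "Pi (Suc n) (\<lambda>z. P (pfst z) (psnd z)) \<Longrightarrow> Pi (Suc n) (\<lambda>x. \<forall>y. P x y)"
  using Sig_ex[of n "\<lambda>x y. \<not> P x y"] by simp

lemma Sig_ex_Pi: "Pi n (\<lambda>z. P (pfst z) (psnd z)) \<Longrightarrow> Sig (Suc n) (\<lambda>x. \<exists>y. P x y)"
  by (intro Sig_ex Sig_of_Pi)

lemma Pi_all_Sig: "Sig n (\<lambda>z. P (pfst z) (psnd z)) \<Longrightarrow> Pi (Suc n) (\<lambda>x. \<forall>y. P x y)"
  by (intro Pi_all Pi_of_Sig)

lemma Pi2_normal_form:
  assumes "Pi 2 P"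
  obtains S where "dec {} S" "\<And>x. P x \<longleftrightarrow> (\<forall>c. \<exists>d. S (pair x (pair c d)))"
proof -
  from assms have "Sig (Suc (Suc 0)) (\<lambda>x. \<not> P x)" by (simp add: numeral_2_eq_2)
  then obtain S where S: "Sig (Suc 0) (\<lambda>z. \<not> S z)" "(\<lambda>x. \<not> P x) = (\<lambda>x. \<exists>y. S (pair x y))"
    by (rule Sig_SucE)
  from S(1) obtain T where T: "Sig 0 (\<lambda>z. \<not> T z)" "(\<lambda>z. \<not> S z) = (\<lambda>x. \<exists>y. T (pair x y))"
    by (rule Sig_SucE)
  have "P x \<longleftrightarrow> (\<forall>c. \<exists>d. T (pair (pair x c) d))" for x
    using S(2) T(2) by metis
  moreover have "dec {} (\<lambda>z. T (pair (pair (pfst z) (pfst (psnd z))) (psnd (psnd z))))"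
    using dec_subst[OF dec_not[OF T(1)[unfolded Sig.simps]], of
      "\<lambda>z. pair (pair (pfst z) (pfst (psnd z))) (psnd (psnd z))"]
    by (simp add: comp_intros)
  ultimately show ?thesis
    by (intro that[of "\<lambda>z. T (pair (pair (pfst z) (pfst (psnd z))) (psnd (psnd z)))"]) simp_all
qed

lemma Pi04_iff_Pi: "Pi04 S \<longleftrightarrow> Pi 4 (\<lambda>x. x \<in> S)"
proof
  assume "Pi04 S"
  then obtain R where R: "dec {} (\<lambda>z. z \<in> R)"
    and S: "\<And>x. x \<in> S \<longleftrightarrow> (\<forall>a. \<exists>b. \<forall>c. \<exists>d. pair x (pair a (pair b (pair c d))) \<in> R)"
    unfolding Pi04_def computable_set_iff_dec by blast
  have "Pi (Suc (Suc (Suc (Suc 0)))) (\<lambda>x. x \<in> S)"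
    unfolding S
    by (intro Pi_all_Sig Sig_ex_Pi Pi_all_Sig Sig_ex_Pi Pi_dec dec_subst[OF R] comp_intros)
  then show "Pi 4 (\<lambda>x. x \<in> S)" by (simp add: eval_nat_numeral)
next
  assume "Pi 4 (\<lambda>x. x \<in> S)"
  then have "Sig (Suc (Suc 2)) (\<lambda>x. x \<notin> S)" by (simp add: eval_nat_numeral)
  then obtain A where A: "Sig (Suc 2) (\<lambda>z. \<not> A z)" "(\<lambda>x. x \<notin> S) = (\<lambda>x. \<exists>y. A (pair x y))"
    by (rule Sig_SucE)
  from A(1) obtain B where B: "Sig 2 (\<lambda>z. \<not> B z)" "(\<lambda>z. \<not> A z) = (\<lambda>x. \<exists>y. B (pair x y))"
    by (rule Sig_SucE)
  from B(1) obtain T where T: "dec {} T" "\<And>x. B x \<longleftrightarrow> (\<forall>c. \<exists>d. T (pair x (pair c d)))"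
    using Pi2_normal_form by blast
  \<comment> \<open>The hierarchy nests the variables to the left as \<open>((x, a), b)\<close>, the
    given definition to the right; \<open>T'\<close> re-associates them.\<close>
  define T' where "T' z = T (pair (pair (pair (pfst z) (pfst (psnd z))) (pfst (psnd (psnd z)))) (psnd (psnd (psnd z))))" for z
  have "computable_set {z. T' z}"
    unfolding computable_set_iff_dec T'_def mem_Collect_eq by (intro dec_subst[OF T(1)] comp_intros)
  moreover have "x \<in> S \<longleftrightarrow> (\<forall>a. \<exists>b. \<forall>c. \<exists>d. pair x (pair a (pair b (pair c d))) \<in> {z. T' z})" for x
    using A(2) B(2) T(2) unfolding T'_def by simp metis
  ultimately show "Pi04 S" unfolding Pi04_def by blast
qed

lemma dec_jump_Sig: "Sig (Suc 0) P \<Longrightarrow> dec (jump {}) P"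
proof -
  assume "Sig (Suc 0) P"
  then obtain S where "dec {} (\<lambda>z. \<not> S z)" "P = (\<lambda>x. \<exists>y. S (pair x y))"
    using Sig_SucE by (metis Sig.simps(1))
  then show ?thesis using dec_jump_ex[of "{}" "\<lambda>x y. S (pair x y)"] dec_not[of "{}" "\<lambda>z. \<not> S z"] by simp
qed

lemma dec_double_jump_Sig2: "Sig (Suc (Suc 0)) P \<Longrightarrow> dec zero_double_jump P"
proof -
  assume "Sig (Suc (Suc 0)) P"
  then obtain S where "Sig (Suc 0) (\<lambda>z. \<not> S z)" and P: "P = (\<lambda>x. \<exists>y. S (pair x y))"
    by (rule Sig_SucE)
  then have "dec (jump {}) S" using dec_not[OF dec_jump_Sig, of "\<lambda>z. \<not> S z"] by (simp only: not_not)
  then show ?thesis unfolding P zero_double_jump_def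
    using dec_jump_ex[of "jump {}" "\<lambda>x y. S (pair x y)"] by simp
qed

section \<open>Evaluation as an arithmetical relation\<close>

abbreviation is_code :: "nat \<Rightarrow> bool" where
  "is_code e \<equiv> e \<in> range enc"

text \<open>\<open>prod_encode (x, y)\<close> is the triangular number of \<open>x + y\<close> plus
  \<open>x\<close>. Hence a constructor with positive tag has a code above those of its
  parts.\<close>

lemma less_pair: "0 < x \<Longrightarrow> y < pair x y"
proof -
  have "n \<le> triangle n" for n by (induction n) auto
  from this[of "x + y"] show "0 < x \<Longrightarrow> y < pair x y" by (simp add: prod_encode_def)
qed

text \<open>Unfolds one constructor, with \<open>S\<close> standing for the codes already known.
  Tags 0 to 4 are the atomic programs, 5 to 7 the binary constructors, 8 is
  \<open>RMu\<close>.\<close>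

definition code_step :: "nat \<Rightarrow> nat set \<Rightarrow> bool" where
  "code_step n S \<longleftrightarrow> (pfst n \<le> 4 \<and> psnd n = 0) \<or>
     (5 \<le> pfst n \<and> pfst n \<le> 7 \<and> pfst (psnd n) \<in> S \<and> psnd (psnd n) \<in> S) \<or>
     (pfst n = 8 \<and> psnd n \<in> S)"

lemma is_code_iff: "is_code n \<longleftrightarrow> code_step n {i. i < n \<and> is_code i}"
proof -
  have lt: "psnd n < n" if "0 < pfst n"
    using less_pair[OF that, of "psnd n"] by simp
  have lt1: "pfst (psnd n) < n" if "0 < pfst n"
    using lt[OF that] le_prod_encode_1[of "pfst (psnd n)" "psnd (psnd n)"] by simp
  have lt2: "psnd (psnd n) < n" if "0 < pfst n"
    using lt[OF that] le_prod_encode_2[of "psnd (psnd n)" "pfst (psnd n)"] by simp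
  show ?thesis
  proof
    assume "is_code n"
    then obtain c where c: "n = enc c" by blast
    show "code_step n {i. i < n \<and> is_code i}"
      using lt lt1 lt2 unfolding c code_step_def by (cases c) simp_all
  next
    assume step: "code_step n {i. i < n \<and> is_code i}"
    have n: "n = pair (pfst n) (psnd n)" and n2: "psnd n = pair (pfst (psnd n)) (psnd (psnd n))"
      by simp_all
    from step show "is_code n" unfolding code_step_def
    proof (elim disjE conjE)
      assume "pfst n \<le> 4" "psnd n = 0"
      then have "n = enc RZero \<or> n = enc RSuc \<or> n = enc RFst \<or> n = enc RSnd \<or> n = enc ROrc"
        by (subst (1 2 3 4 5) n) (auto simp: le_Suc_eq eval_nat_numeral)
      then show ?thesis by blast
    next
      assume *: "5 \<le> pfst n" "pfst n \<le> 7"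
        "pfst (psnd n) \<in> {i. i < n \<and> is_code i}" "psnd (psnd n) \<in> {i. i < n \<and> is_code i}"
      then obtain c d where "pfst (psnd n) = enc c" "psnd (psnd n) = enc d" by blast
      then have "n = pair (pfst n) (pair (enc c) (enc d))" using n n2 by metis
      moreover have "pfst n = 5 \<or> pfst n = 6 \<or> pfst n = 7" using * by linarith
      ultimately have "n = enc (RComp c d) \<or> n = enc (RPair c d) \<or> n = enc (RRec c d)"
        unfolding enc.simps by metis
      then show ?thesis by blast
    next
      assume *: "pfst n = 8" "psnd n \<in> {i. i < n \<and> is_code i}"
      then obtain c where "psnd n = enc c" by blast
      then have "n = enc (RMu c)" unfolding enc.simps using n *(1) by metis
      then show ?thesis by blast
    qed
  qed
qed

text \<open>Needed because \<open>prog\<close> falls back to \<open>RZero\<close> on numbers that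
  are not codes. The proof is course-of-values recursion: \<open>T n\<close> is the bit mask of the
  codes below \<open>n\<close>.\<close>

lemma dec_is_code: "dec X is_code"
proof -
  define T where "T n = rec_nat 0 (\<lambda>n r. if code_step n (set_decode r) then 2 ^ n + r else r) n" for n
  have T: "set_decode (T n) = {i. i < n \<and> is_code i}" for n
  proof (induction n)
    case 0
    show ?case by (simp add: T_def set_decode_def)
  next
    case (Suc n)
    have "set_decode (T (Suc n)) = (if is_code n then insert n (set_decode (T n)) else set_decode (T n))"
      using Suc is_code_iff[of n] set_decode_plus_power_2[of n "T n"] by (simp add: T_def)
    then show ?case using Suc by (auto simp: less_Suc_eq)
  qed
  have "dec X (\<lambda>x. x \<in> set_decode (T (Suc x)))"
    unfolding T_def code_step_def by (intro dec_intros comp_rec comp_if comp_intros)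
  then show ?thesis unfolding T by simp
qed

section \<open>Finite certificates for evaluation\<close>

abbreviation trip :: "nat \<Rightarrow> nat \<Rightarrow> nat \<Rightarrow> nat" where
  "trip c x y \<equiv> pair c (pair x y)"

text \<open>A set of triples \<open>(c, x, y)\<close>, read as the claims that the program coded by \<open>c\<close> yields \<open>y\<close> on \<open>x\<close>,
  is closed if each claim is justified by claims in the set. Justification only uses claims about
  smaller programs, or about the same program and a smaller recursion argument, so it is
  well-founded and a closed set contains true claims only.\<close>

definition justified0 :: "nat set \<Rightarrow> nat \<Rightarrow> nat \<Rightarrow> nat \<Rightarrow> bool" where
  "justified0 S c x y \<longleftrightarrow>
     (c = pair 0 0 \<and> y = 0) \<or> (c = pair 1 0 \<and> y = Suc x) \<or>
     (c = pair 2 0 \<and> y = pfst x) \<or> (c = pair 3 0 \<and> y = psnd x) \<or>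
     (pfst c = 5 \<and> (\<exists>v. trip (psnd (psnd c)) x v \<in> S \<and> trip (pfst (psnd c)) v y \<in> S)) \<or>
     (pfst c = 6 \<and> trip (pfst (psnd c)) x (pfst y) \<in> S \<and> trip (psnd (psnd c)) x (psnd y) \<in> S) \<or>
     (pfst c = 7 \<and> pfst x = 0 \<and> trip (pfst (psnd c)) (psnd x) y \<in> S) \<or>
     (pfst c = 7 \<and> 0 < pfst x \<and> (\<exists>r. trip c (pair (pfst x - 1) (psnd x)) r \<in> S \<and>
        trip (psnd (psnd c)) (pair (pfst x - 1) (pair r (psnd x))) y \<in> S)) \<or>
     (pfst c = 8 \<and> trip (psnd c) (pair y x) 0 \<in> S \<and>
        (\<forall>m<y. \<exists>v. v \<noteq> 0 \<and> trip (psnd c) (pair m x) v \<in> S))"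

text \<open>The oracle clause is kept apart because it alone depends on \<open>A\<close>; its two
  cases use \<open>A\<close> once positively and once negatively, so that each can be classified
  separately.\<close>

definition justified :: "nat set \<Rightarrow> nat set \<Rightarrow> nat \<Rightarrow> nat \<Rightarrow> nat \<Rightarrow> bool" where
  "justified A S c x y \<longleftrightarrow> justified0 S c x y \<or> (c = pair 4 0 \<and> (x \<in> A \<and> y = 1 \<or> x \<notin> A \<and> y = 0))"

definition closed :: "nat set \<Rightarrow> nat set \<Rightarrow> bool" where
  "closed A S \<longleftrightarrow> (\<forall>c x y. trip c x y \<in> S \<longrightarrow> justified A S c x y)"

lemma closed_sound: "closed A S \<Longrightarrow> trip (enc p) x y \<in> S \<Longrightarrow> ev A p x y"
proof (induction p arbitrary: x y)
  case (RComp f g)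
  then have "justified A S (enc (RComp f g)) x y" unfolding closed_def by blast
  then obtain v where "trip (enc g) x v \<in> S" "trip (enc f) v y \<in> S"
    by (auto simp: justified_def justified0_def)
  then show ?case using RComp unfolding ev_comp_iff by blast
next
  case (RPair f g)
  then have "justified A S (enc (RPair f g)) x y" unfolding closed_def by blast
  then have "ev A f x (pfst y)" "ev A g x (psnd y)"
    using RPair by (auto simp: justified_def justified0_def)
  then show ?case using ev.ev_pair[of A f x "pfst y" g "psnd y"] by simp
next
  case (RRec f g)
  obtain n a where x: "x = pair n a" by (metis prod_decode_inverse surj_pair)
  have "trip (enc (RRec f g)) (pair n a) y \<in> S \<Longrightarrow> ev A (RRec f g) (pair n a) y"
  proof (induction n arbitrary: y)
    case 0
    then have "justified A S (enc (RRec f g)) (pair 0 a) y" using RRec.prems(1) unfolding closed_def by blast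
    then show ?case using RRec by (auto simp: justified_def justified0_def ev_rec0_iff)
  next
    case (Suc n)
    then have "justified A S (enc (RRec f g)) (pair (Suc n) a) y" using RRec.prems(1) unfolding closed_def by blast
    then obtain r where "trip (enc (RRec f g)) (pair n a) r \<in> S" "trip (enc g) (pair n (pair r a)) y \<in> S"
      by (auto simp: justified_def justified0_def)
    then show ?case using Suc.IH RRec.IH(2) RRec.prems(1) unfolding ev_recS_iff by blast
  qed
  then show ?case using RRec.prems(2) x by blast
next
  case (RMu f)
  then have "justified A S (enc (RMu f)) x y" unfolding closed_def by blast
  then have "trip (enc f) (pair y x) 0 \<in> S" "\<forall>m<y. \<exists>v. v \<noteq> 0 \<and> trip (enc f) (pair m x) v \<in> S"
    by (auto simp: justified_def justified0_def)
  then show ?case using RMu unfolding ev_mu_iff by blast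
next
  case ROrc
  then have "justified A S (enc ROrc) x y" unfolding closed_def by blast
  then show ?case by (auto simp: justified_def justified0_def ev_orc_iff chi_def)
qed (force simp: closed_def justified_def justified0_def ev_iffs)+

lemma justified_mono: "justified A S c x y \<Longrightarrow> S \<subseteq> T \<Longrightarrow> justified A T c x y"
  unfolding justified_def justified0_def
  by (elim disj_forward conj_forward ex_forward all_forward imp_forward; (assumption | erule subsetD))

lemma closed_Union: "(\<And>S. S \<in> F \<Longrightarrow> closed A S) \<Longrightarrow> closed A (\<Union>F)"
  unfolding closed_def by (meson UnionE Union_upper justified_mono)

lemma closed_insert:
  assumes "closed A S" "justified A S c x y"
  shows "closed A (insert (trip c x y) S)"
  using assms unfolding closed_def
  by (auto intro: justified_mono[OF _ subset_insertI])

text \<open>Certificates of the premises are united, which keeps them closed, and the conclusion is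
  added. Finiteness permits coding the certificate as a number.\<close>

lemma closed_complete:
  "ev A p x y \<Longrightarrow> \<exists>S. finite S \<and> closed A S \<and> trip (enc p) x y \<in> S"
proof (induction rule: ev.induct)
  let ?C = "\<lambda>p x y. \<exists>S. finite S \<and> closed A S \<and> trip (enc p) x y \<in> S"
  have extend: "?C p x y" if "finite S" "closed A S" "justified A S (enc p) x y" for S p x y
    using closed_insert[OF that(2,3)] that(1) by (intro exI[of _ "insert (trip (enc p) x y) S"]) simp
  have base: "?C p x y" if "justified A {} (enc p) x y" for p x y
    by (rule extend[OF _ _ that]) (simp_all add: closed_def)
  have step: "?C p x y" if "?C q u v" "?C r w z"
    "\<And>S. trip (enc q) u v \<in> S \<Longrightarrow> trip (enc r) w z \<in> S \<Longrightarrow> justified A S (enc p) x y"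
    for p x y q u v r w z
  proof -
    obtain S T where S: "finite S" "closed A S" "trip (enc q) u v \<in> S"
      and T: "finite T" "closed A T" "trip (enc r) w z \<in> T"
      using \<open>?C q u v\<close> \<open>?C r w z\<close> by blast
    have "closed A (S \<union> T)" using closed_Union[of "{S, T}"] S T by auto
    then show ?thesis using S T that(3) by (intro extend[of "S \<union> T"]) auto
  qed
  {
    case (ev_zero x)
    show ?case by (rule base) (simp add: justified_def justified0_def)
  next
    case (ev_suc x)
    show ?case by (rule base) (simp add: justified_def justified0_def)
  next
    case (ev_fst x)
    show ?case by (rule base) (simp add: justified_def justified0_def)
  next
    case (ev_snd x)
    show ?case by (rule base) (simp add: justified_def justified0_def)
  next
    case (ev_orc x)
    show ?case by (rule base) (simp add: justified_def justified0_def)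
  next
    case (ev_comp g x y f z)
    show ?case by (rule step[OF ev_comp.IH]) (auto simp: justified_def justified0_def)
  next
    case (ev_pair f x y g z)
    show ?case by (rule step[OF ev_pair.IH]) (auto simp: justified_def justified0_def)
  next
    case (ev_rec0 f a y g)
    show ?case by (rule step[OF ev_rec0.IH ev_rec0.IH]) (auto simp: justified_def justified0_def)
  next
    case (ev_recS f g n a r y)
    show ?case by (rule step[OF ev_recS.IH]) (auto simp: justified_def justified0_def)
  next
    case (ev_mu f n x)
    obtain S where S: "finite S" "closed A S" "trip (enc f) (pair n x) 0 \<in> S"
      using ev_mu.IH(1) by blast
    from ev_mu.IH(2) have "\<forall>m<n. \<exists>y T. y \<noteq> 0 \<and> finite T \<and> closed A T \<and> trip (enc f) (pair m x) y \<in> T"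
      by blast
    then obtain v T where T: "\<And>m. m < n \<Longrightarrow> v m \<noteq> 0 \<and> finite (T m) \<and> closed A (T m) \<and>
        trip (enc f) (pair m x) (v m) \<in> T m"
      by metis
    define U where "U = \<Union> (insert S (T ` {..<n}))"
    have "finite U" unfolding U_def using S T by auto
    moreover have "closed A U" unfolding U_def by (rule closed_Union) (use S T in auto)
    moreover have "justified A U (enc (RMu f)) x n"
      unfolding justified_def justified0_def U_def using S T by auto
    ultimately show ?case by (rule extend)
  }
qed

lemma ev_prog_iff:
  "ev A (prog e) x y \<longleftrightarrow> (if is_code e then \<exists>D. closed A (set_decode D) \<and> trip e x y \<in> set_decode D else y = 0)"
proof (cases "is_code e")
  case True
  then obtain p where p: "e = enc p" by blast
  have "(\<exists>D. closed A (set_decode D) \<and> trip (enc p) x y \<in> set_decode D) \<longleftrightarrow> ev A p x y"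
    using closed_sound closed_complete set_encode_inverse by metis
  then show ?thesis unfolding p prog_enc by simp
next
  case False
  then have "prog e = RZero" unfolding prog_def by auto
  then show ?thesis using False by (simp add: ev_zero_iff)
qed

lemma mem_set_decode_less: "x \<in> set_decode D \<Longrightarrow> x < D"
proof -
  assume "x \<in> set_decode D"
  then have "D div 2 ^ x \<noteq> 0" by (auto simp: set_decode_def elim: oddE)
  then have "2 ^ x \<le> D" by (meson div_less not_le)
  then show "x < D" using less_exp[of x] by linarith
qed

lemma trip_less: "trip c x y \<in> set_decode D \<Longrightarrow> y < D"
  using mem_set_decode_less[of "trip c x y" D] le_prod_encode_2[of "pair x y" c] le_prod_encode_2[of y x]
  by linarith

lemma dec_justified0:
  "dec {} (\<lambda>z. justified0 (set_decode (pfst z)) (pfst (psnd z)) (pfst (psnd (psnd z))) (psnd (psnd (psnd z))))"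
proof -
  \<comment> \<open>An intermediate value \<open>v\<close> occurs in a triple of the set coded by
    \<open>D\<close>, so \<open>D\<close> bounds it and the quantifier becomes bounded. The two
    equivalences match the two orders of the conjuncts.\<close>
  have *: "(\<exists>v. P v \<and> trip (c v) (x v) v \<in> set_decode D) \<longleftrightarrow> (\<exists>v<D. P v \<and> trip (c v) (x v) v \<in> set_decode D)"
    for P c x D using trip_less by blast
  have **: "(\<exists>v. trip (c v) (x v) v \<in> set_decode D \<and> P v) \<longleftrightarrow> (\<exists>v<D. trip (c v) (x v) v \<in> set_decode D \<and> P v)"
    for P c x D using trip_less by blast
  show ?thesis unfolding justified0_def * **
    by (intro dec_intros comp_intros)
qed

text \<open>The search for a certificate \<open>D\<close> is one existential quantifier; checking
  \<open>D\<close> takes bounded quantifiers, decidable clauses and positive or negative oracle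
  claims, both Sigma by the hypotheses on \<open>A\<close>.\<close>

lemma Sig_ev:
  assumes "Sig (Suc n) (\<lambda>x. x \<in> A)" "Pi (Suc n) (\<lambda>x. x \<in> A)"
  shows "Sig (Suc n) (\<lambda>z. ev A (prog (pfst z)) (pfst (psnd z)) (psnd (psnd z)))"
proof -
  have closed: "closed A (set_decode D) \<longleftrightarrow>
      (\<forall>t<D. t \<notin> set_decode D \<or> justified A (set_decode D) (pfst t) (pfst (psnd t)) (psnd (psnd t)))" for D
    unfolding closed_def using mem_set_decode_less
    by (metis fst_conv prod.collapse prod_decode_inverse prod_encode_inverse snd_conv)
  have "dec {} (\<lambda>z. justified0 (set_decode (pfst z)) (pfst (psnd z)) (pfst (psnd (psnd z))) (psnd (psnd (psnd z))))"
    by (rule dec_justified0)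
  note just = Sig_subst[OF Sig_dec[OF this], of "\<lambda>z. pair (f z) (g z)" for f g, simplified]
  have ev: "ev A (prog e) x y \<longleftrightarrow>
    (is_code e \<and> (\<exists>D. closed A (set_decode D) \<and> trip e x y \<in> set_decode D)) \<or> (\<not> is_code e \<and> y = 0)" for e x y
    by (simp add: ev_prog_iff)
  show ?thesis unfolding ev closed justified_def
    by (intro Sig_disj Sig_conj Sig_ex Sig_ball just Sig_subst[OF assms(1)] Sig_subst[OF assms(2)]
        Sig_dec[OF dec_mem_set_decode] Sig_dec[OF dec_not[OF dec_mem_set_decode]]
        Sig_dec[OF dec_eq] Sig_dec[OF dec_not[OF dec_subst[OF dec_is_code]]]
        Sig_dec[OF dec_subst[OF dec_is_code]] comp_intros)
qed

lemma Sig1_ev: "Sig (Suc 0) (\<lambda>z. ev {} (prog (pfst z)) (pfst (psnd z)) (psnd (psnd z)))"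
  by (rule Sig_ev) (auto intro!: Sig_dec dec_const)

lemma Sig1_jump: "Sig (Suc 0) (\<lambda>x. x \<in> jump {})"
  unfolding jump_def mem_Collect_eq
  using Sig_subst[OF Sig1_ev, of "\<lambda>z. pair (pfst z) (pair (pfst z) (psnd z))"]
  by (intro Sig_ex) (simp add: comp_intros)

text \<open>\<open>jump {}\<close> is Sigma 1, hence both Sigma and Pi at level 2, as
  \<open>Sig_ev\<close> requires of an oracle.\<close>

lemma Sig2_double_jump: "Sig (Suc (Suc 0)) (\<lambda>x. x \<in> zero_double_jump)"
proof -
  have "Sig (Suc (Suc 0)) (\<lambda>z. ev (jump {}) (prog (pfst z)) (pfst (psnd z)) (psnd (psnd z)))"
    by (rule Sig_ev[OF Sig_Suc[OF Sig1_jump] Pi_of_Sig[OF Sig1_jump]])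
  then show ?thesis unfolding zero_double_jump_def jump_def[of "jump {}"] mem_Collect_eq
    using Sig_subst[of _ _ "\<lambda>z. pair (pfst z) (pair (pfst z) (psnd z))"]
    by (intro Sig_ex) (fastforce simp: comp_intros)
qed

section \<open>Embeddings of equivalence structures\<close>

text \<open>Outside \<open>U\<close> the first disjunct makes the search stop at 0, so that the
  function is total.\<close>

definition rep :: "nat set \<Rightarrow> (nat \<times> nat) set \<Rightarrow> nat \<Rightarrow> nat" where
  "rep U E x = (LEAST y. x \<notin> U \<or> (y, x) \<in> E)"

definition reps :: "nat set \<Rightarrow> (nat \<times> nat) set \<Rightarrow> nat set" where
  "reps U E = {m \<in> U. \<forall>u<m. (u, m) \<notin> E}"

definition inf_reps :: "nat set \<Rightarrow> (nat \<times> nat) set \<Rightarrow> nat set" where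
  "inf_reps U E = {m \<in> reps U E. infinite (E `` {m})}"

text \<open>For \<open>m\<close> in the class of \<open>r\<close> this is the rank of
  \<open>m\<close> in its class. That the class has at least \<open>k\<close> elements becomes the
  existential statement \<open>\<exists>m. k \<le> cnt E r m\<close>.\<close>

definition cnt :: "(nat \<times> nat) set \<Rightarrow> nat \<Rightarrow> nat \<Rightarrow> nat" where
  "cnt E r m = card {z. z < m \<and> (r, z) \<in> E}"

lemma equiv_memD: "equiv U E \<Longrightarrow> (x, y) \<in> E \<Longrightarrow> x \<in> U \<and> y \<in> U"
  by (auto simp: equiv_def refl_on_def)

lemma equiv_symD: "equiv U E \<Longrightarrow> (x, y) \<in> E \<Longrightarrow> (y, x) \<in> E"
  by (meson equivE symE)

lemma equiv_transD: "equiv U E \<Longrightarrow> (x, y) \<in> E \<Longrightarrow> (y, z) \<in> E \<Longrightarrow> (x, z) \<in> E"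
  by (meson equivE transE)

lemma equiv_reflD: "equiv U E \<Longrightarrow> x \<in> U \<Longrightarrow> (x, x) \<in> E"
  by (meson equivE refl_onD)

lemma rep_related:
  assumes "equiv U E" "x \<in> U"
  shows "(rep U E x, x) \<in> E"
proof -
  have "x \<notin> U \<or> (rep U E x, x) \<in> E"
    unfolding rep_def by (rule LeastI[of _ x]) (simp add: equiv_reflD[OF assms])
  then show ?thesis using assms(2) by blast
qed

lemma rep_in_reps:
  assumes "equiv U E" "x \<in> U"
  shows "rep U E x \<in> reps U E"
proof -
  have "(u, rep U E x) \<notin> E" if "u < rep U E x" for u
  proof
    assume "(u, rep U E x) \<in> E"
    then have "(u, x) \<in> E" by (rule equiv_transD[OF assms(1) _ rep_related[OF assms]])
    then show False using not_less_Least[OF that[unfolded rep_def]] by blast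
  qed
  then show ?thesis unfolding reps_def using equiv_memD[OF assms(1) rep_related[OF assms]] by blast
qed

lemma reps_unique:
  assumes "equiv U E" "r \<in> reps U E" "s \<in> reps U E" "(r, s) \<in> E"
  shows "r = s"
proof -
  have "\<not> r < s" "\<not> s < r" using assms(2-4) equiv_symD[OF assms(1,4)] by (auto simp: reps_def)
  then show ?thesis by simp
qed

lemma rep_eq_iff:
  assumes "equiv U E" "x \<in> U" "y \<in> U"
  shows "rep U E x = rep U E y \<longleftrightarrow> (x, y) \<in> E"
proof
  note x = rep_related[OF assms(1,2)] and y = rep_related[OF assms(1,3)]
  show "(x, y) \<in> E" if "rep U E x = rep U E y"
    by (rule equiv_transD[OF assms(1) equiv_symD[OF assms(1) x] y[folded that]])
  show "rep U E x = rep U E y" if "(x, y) \<in> E"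
    by (rule reps_unique[OF assms(1) rep_in_reps[OF assms(1,2)] rep_in_reps[OF assms(1,3)]
          equiv_transD[OF assms(1) equiv_transD[OF assms(1) x that] equiv_symD[OF assms(1) y]]])
qed

lemma reps_subset: "reps U E \<subseteq> U"
  by (auto simp: reps_def)

lemma finite_less_conj: "finite {z::nat. z < m \<and> P z}"
  by (rule finite_subset[of _ "{..<m}"]) auto

lemma cnt_0 [simp]: "cnt E r 0 = 0"
  by (simp add: cnt_def)

lemma cnt_Suc: "cnt E r (Suc m) = (if (r, m) \<in> E then Suc (cnt E r m) else cnt E r m)"
proof -
  have "{z. z < Suc m \<and> (r, z) \<in> E} =
      (if (r, m) \<in> E then insert m {z. z < m \<and> (r, z) \<in> E} else {z. z < m \<and> (r, z) \<in> E})"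
    by (auto simp: less_Suc_eq)
  then show ?thesis by (simp add: cnt_def finite_less_conj)
qed

lemma cnt_mono: "m \<le> n \<Longrightarrow> cnt E r m \<le> cnt E r n"
  unfolding cnt_def by (intro card_mono finite_less_conj) auto

lemma cnt_strict: "(r, x) \<in> E \<Longrightarrow> x < y \<Longrightarrow> cnt E r x < cnt E r y"
  using cnt_mono[of "Suc x" y E r] by (simp add: cnt_Suc)

lemma cnt_reach: "n < cnt E r m \<Longrightarrow> \<exists>z. (r, z) \<in> E \<and> cnt E r z = n"
  by (induction m) (auto simp: cnt_Suc less_Suc_eq split: if_splits)

lemma cnt_class_cong:
  assumes "equiv U E" "(r, s) \<in> E"
  shows "cnt E r = cnt E s"
proof -
  have "(r, z) \<in> E \<longleftrightarrow> (s, z) \<in> E" for z using assms equiv_symD equiv_transD by metis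
  then show ?thesis by (auto simp: cnt_def fun_eq_iff)
qed

lemma card_le_cnt:
  assumes "finite T" "T \<subseteq> E `` {r}"
  shows "\<exists>m. card T \<le> cnt E r m"
proof -
  obtain m where "\<forall>x\<in>T. x < m" using assms(1) finite_nat_set_iff_bounded by blast
  then have "card T \<le> cnt E r m"
    unfolding cnt_def using assms(2) by (intro card_mono finite_less_conj) auto
  then show ?thesis by blast
qed

lemma le_cnt_of_infinite:
  assumes "infinite (E `` {r})"
  shows "\<exists>m. n \<le> cnt E r m"
proof -
  obtain T where "finite T" "card T = n" "T \<subseteq> E `` {r}"
    using infinite_arbitrarily_large[OF assms] by blast
  then show ?thesis using card_le_cnt by metis
qed

lemma cnt_le_embedding:
  assumes "embedding g U1 E1 U2 E2" "equiv U1 E1" "r \<in> U1"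
  shows "\<exists>m'. cnt E1 r m \<le> cnt E2 (g r) m'"
proof -
  let ?T = "{z. z < m \<and> (r, z) \<in> E1}"
  have T: "?T \<subseteq> U1" using equiv_memD[OF assms(2)] by blast
  have "card (g ` ?T) = cnt E1 r m"
    unfolding cnt_def using assms(1) T inj_on_subset by (intro card_image) (auto simp: embedding_def)
  moreover have "g ` ?T \<subseteq> E2 `` {g r}"
    using assms(1,3) T unfolding embedding_def by auto
  moreover have "finite (g ` ?T)" by (simp add: finite_less_conj)
  ultimately show ?thesis using card_le_cnt[of "g ` ?T" E2 "g r"] by simp
qed

lemma embeds_trans: "embeds U1 E1 U2 E2 \<Longrightarrow> embeds U2 E2 U3 E3 \<Longrightarrow> embeds U1 E1 U3 E3"
proof -
  assume "embeds U1 E1 U2 E2" "embeds U2 E2 U3 E3"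
  then obtain f g where f: "embedding f U1 E1 U2 E2" and g: "embedding g U2 E2 U3 E3"
    by (auto simp: embeds_def)
  have "inj_on (g \<circ> f) U1"
    using f g inj_on_subset by (intro comp_inj_on) (auto simp: embedding_def)
  then have "embedding (g \<circ> f) U1 E1 U3 E3"
    using f g unfolding embedding_def by (auto simp: image_subset_iff)
  then show ?thesis by (auto simp: embeds_def)
qed

lemma inj_on_rep_embedding:
  assumes "embedding g U1 E1 U2 E2" "equiv U1 E1" "equiv U2 E2"
  shows "inj_on (\<lambda>r. rep U2 E2 (g r)) (reps U1 E1)"
proof (rule inj_onI)
  fix r s assume rs: "r \<in> reps U1 E1" "s \<in> reps U1 E1" "rep U2 E2 (g r) = rep U2 E2 (g s)"
  have U: "r \<in> U1" "s \<in> U1" using rs reps_subset by auto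
  then have "(g r, g s) \<in> E2"
    using rs(3) assms(1) rep_eq_iff[OF assms(3)] by (auto simp: embedding_def image_subset_iff)
  then have "(r, s) \<in> E1" using U assms(1) by (auto simp: embedding_def)
  then show "r = s" using reps_unique assms(2) rs by blast
qed

text \<open>Distinct infinite classes are sent into distinct classes, which are then infinite. This
  makes the criterion invariant under bi-embeddability.\<close>

lemma infinite_inf_reps_embedding:
  assumes g: "embedding g U1 E1 U2 E2" and "equiv U1 E1" and eq2: "equiv U2 E2"
    and "infinite (inf_reps U1 E1)"
  shows "infinite (inf_reps U2 E2)"
proof -
  have sub: "inf_reps U1 E1 \<subseteq> reps U1 E1" by (auto simp: inf_reps_def)
  have "rep U2 E2 (g r) \<in> inf_reps U2 E2" if r: "r \<in> inf_reps U1 E1" for r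
  proof -
    have U: "r \<in> U1" using r sub reps_subset by blast
    then have gU: "g r \<in> U2" using g by (auto simp: embedding_def)
    have cl: "E1 `` {r} \<subseteq> U1" using equiv_memD[OF assms(2)] by blast
    have "infinite (g ` (E1 `` {r}))"
      using r g cl unfolding inf_reps_def embedding_def by (metis (no_types, lifting) finite_imageD inj_on_subset mem_Collect_eq)
    moreover have "(rep U2 E2 (g r), g z) \<in> E2" if "(r, z) \<in> E1" for z
      using equiv_transD[OF eq2 rep_related[OF eq2 gU]] g U cl that unfolding embedding_def by auto
    then have "g ` (E1 `` {r}) \<subseteq> E2 `` {rep U2 E2 (g r)}" by auto
    ultimately have "infinite (E2 `` {rep U2 E2 (g r)})" using finite_subset by blast
    then show ?thesis using rep_in_reps[OF eq2 gU] by (simp add: inf_reps_def)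
  qed
  moreover have "infinite ((\<lambda>r. rep U2 E2 (g r)) ` inf_reps U1 E1)"
    using inj_on_subset[OF inj_on_rep_embedding[OF assms(1-3)] sub] assms(4) finite_imageD by blast
  ultimately show ?thesis by (meson finite_subset image_subsetI)
qed

section \<open>Algorithms on computable equivalence structures\<close>

lemma
  assumes "computable_eq_struct U E"
  shows dec_universe: "dec X (\<lambda>x. x \<in> U)"
    and dec_relation: "computable_in X f \<Longrightarrow> computable_in X g \<Longrightarrow> dec X (\<lambda>x. (f x, g x) \<in> E)"
proof -
  show "dec X (\<lambda>x. x \<in> U)"
    by (rule dec_of_empty) (use assms in \<open>simp add: computable_eq_struct_def computable_set_iff_dec\<close>)
  have "z \<in> {prod_encode (x, y) | x y. (x, y) \<in> E} \<longleftrightarrow> (pfst z, psnd z) \<in> E" for z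
    by (auto, metis prod.collapse prod_decode_inverse)
  then have "dec {} (\<lambda>z. (pfst z, psnd z) \<in> E)"
    using assms by (simp add: computable_eq_struct_def computable_set_iff_dec)
  from dec_subst[OF dec_of_empty[OF this] comp_pair, of X f g]
  show "dec X (\<lambda>x. (f x, g x) \<in> E)" if "computable_in X f" "computable_in X g"
    using that by simp
qed

lemma comp_eq_struct_equiv: "computable_eq_struct U E \<Longrightarrow> equiv U E"
  by (simp add: computable_eq_struct_def)

lemma comp_cnt:
  assumes "computable_eq_struct U E" "computable_in X f" "computable_in X g"
  shows "computable_in X (\<lambda>x. cnt E (f x) (g x))"
proof -
  have "cnt E r m = rec_nat 0 (\<lambda>i n. if (r, i) \<in> E then Suc n else n) m" for r m
    by (induction m) (auto simp: cnt_Suc)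
  then show ?thesis
    by (simp only:) (intro comp_rec comp_if dec_relation[OF assms(1)] comp_comp[OF assms(2)] assms comp_intros)
qed

lemma comp_rep:
  assumes "computable_eq_struct U E"
  shows "computable_in X (rep U E)"
proof -
  have "\<exists>y. x \<notin> U \<or> (y, x) \<in> E" for x
    using equiv_reflD[OF comp_eq_struct_equiv[OF assms]] by blast
  then show ?thesis unfolding rep_def
    by (intro comp_Least dec_disj dec_not dec_relation[OF assms] dec_subst[OF dec_universe[OF assms]] comp_intros)
qed

lemma dec_reps:
  assumes "computable_eq_struct U E"
  shows "dec X (\<lambda>x. x \<in> reps U E)"
  unfolding reps_def mem_Collect_eq
  by (intro dec_intros dec_relation[OF assms] dec_universe[OF assms] comp_intros)

lemma Pi2_inf_reps:
  assumes "computable_eq_struct U E"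
  shows "Pi (Suc (Suc 0)) (\<lambda>x. x \<in> inf_reps U E)"
  unfolding inf_reps_def mem_Collect_eq infinite_nat_iff_unbounded Image_singleton_iff
  by (intro Pi_conj Pi_all_Sig Sig_ex Sig_dec[OF dec_conj] Pi_dec dec_reps[OF assms] dec_less
      dec_relation[OF assms] comp_intros)

text \<open>A map \<open>t\<close> of representatives suffices: \<open>x\<close> goes to the element
  of the class of \<open>t (rep U1 E1 x)\<close> that has the same rank as \<open>x\<close> in its
  own class. \<open>size\<close> makes this search succeed, \<open>sep\<close> keeps distinct
  classes apart.\<close>

lemma embedding_of_rep_map:
  assumes C1: "computable_eq_struct U1 E1" and C2: "computable_eq_struct U2 E2"
    and t: "computable_in X t"
    and size: "\<And>r m. r \<in> reps U1 E1 \<Longrightarrow> \<exists>m'. cnt E1 r m \<le> cnt E2 (t r) m'"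
    and sep: "\<And>r s. r \<in> reps U1 E1 \<Longrightarrow> s \<in> reps U1 E1 \<Longrightarrow> (t r, t s) \<in> E2 \<Longrightarrow> r = s"
  shows "\<exists>f. computable_in X f \<and> embedding f U1 E1 U2 E2"
proof -
  note eq1 = comp_eq_struct_equiv[OF C1] and eq2 = comp_eq_struct_equiv[OF C2]
  define P where "P x z \<longleftrightarrow> x \<notin> U1 \<or> ((t (rep U1 E1 x), z) \<in> E2 \<and>
      cnt E2 (t (rep U1 E1 x)) z = cnt E1 (rep U1 E1 x) x)" for x z
  define f where "f x = (LEAST z. P x z)" for x
  have ex: "\<exists>z. P x z" for x
  proof (cases "x \<in> U1")
    case True
    have "cnt E1 (rep U1 E1 x) x < cnt E1 (rep U1 E1 x) (Suc x)"
      using rep_related[OF eq1 True] by (simp add: cnt_Suc)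
    then have "\<exists>m'. cnt E1 (rep U1 E1 x) x < cnt E2 (t (rep U1 E1 x)) m'"
      using size[OF rep_in_reps[OF eq1 True]] less_le_trans by blast
    then show ?thesis using cnt_reach unfolding P_def by blast
  qed (simp add: P_def)
  have "computable_in X f" unfolding f_def
    using ex unfolding P_def
    by (intro comp_Least dec_intros dec_relation[OF C2] comp_cnt[OF C2] comp_cnt[OF C1]
        comp_comp[OF t] comp_comp[OF comp_rep[OF C1]] dec_subst[OF dec_universe[OF C1]] comp_intros) auto
  moreover have "embedding f U1 E1 U2 E2"
  proof -
    have f: "(t (rep U1 E1 x), f x) \<in> E2" "cnt E2 (t (rep U1 E1 x)) (f x) = cnt E1 (rep U1 E1 x) x"
      if "x \<in> U1" for x
      using LeastI_ex[OF ex[of x]] that unfolding f_def P_def by auto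
    have iff: "(x, y) \<in> E1 \<longleftrightarrow> (f x, f y) \<in> E2" if "x \<in> U1" "y \<in> U1" for x y
    proof
      assume "(x, y) \<in> E1"
      then have "rep U1 E1 x = rep U1 E1 y" using rep_eq_iff[OF eq1 that] by blast
      then show "(f x, f y) \<in> E2" using f(1)[OF that(1)] f(1)[OF that(2)] eq2 equiv_symD equiv_transD by metis
    next
      assume "(f x, f y) \<in> E2"
      then have "(t (rep U1 E1 x), t (rep U1 E1 y)) \<in> E2"
        using f(1)[OF that(1)] f(1)[OF that(2)] eq2 equiv_symD equiv_transD by metis
      then show "(x, y) \<in> E1" using sep rep_in_reps[OF eq1] rep_eq_iff[OF eq1] that by blast
    qed
    have "inj_on f U1"
    proof (rule inj_onI)
      fix x y assume xy: "x \<in> U1" "y \<in> U1" "f x = f y"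
      then have "(f x, f y) \<in> E2" using f(1) equiv_memD[OF eq2] equiv_reflD[OF eq2] by metis
      then have E: "(x, y) \<in> E1" using iff xy by blast
      then have r: "rep U1 E1 x = rep U1 E1 y" using rep_eq_iff[OF eq1] xy by blast
      then have "cnt E1 (rep U1 E1 x) x = cnt E1 (rep U1 E1 x) y" using f(2) xy by metis
      moreover have "(rep U1 E1 x, x) \<in> E1" "(rep U1 E1 x, y) \<in> E1"
        using rep_related[OF eq1] xy r by metis+
      ultimately show "x = y" using cnt_strict by (metis linorder_neqE_nat less_irrefl)
    qed
    then show ?thesis unfolding embedding_def using iff f(1) equiv_memD[OF eq2] by blast
  qed
  ultimately show ?thesis by blast
qed

text \<open>Searching above the previous value makes the choices pairwise distinct; arbitrary
  choices could coincide even though each set is infinite.\<close>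

lemma increasing_choice:
  assumes dec: "dec X (\<lambda>z. D (pfst z) (psnd z))" and inf: "\<And>n. infinite {y. D n y}"
  shows "\<exists>t. computable_in X t \<and> strict_mono t \<and> (\<forall>n. D n (t n))"
proof -
  have ex: "\<exists>y. k < y \<and> D n y" for n k
    using inf[of n] unfolding infinite_nat_iff_unbounded by blast
  define t where "t n = rec_nat (LEAST y. 0 < y \<and> D 0 y) (\<lambda>n r. LEAST y. r < y \<and> D (Suc n) y) n" for n
  have least: "k < (LEAST y. k < y \<and> D n y) \<and> D n (LEAST y. k < y \<and> D n y)" for k n
    by (rule LeastI_ex[OF ex])
  have "D n (t n)" for n by (cases n) (simp_all add: t_def least)
  moreover have "strict_mono t" unfolding strict_mono_Suc_iff by (simp add: t_def least)
  moreover have "computable_in X t" unfolding t_def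
    using dec_subst[OF dec, of "\<lambda>x. pair (f x) (g x)" for f g, simplified] ex
    by (intro comp_rec comp_Least dec_conj dec_less comp_intros) (simp_all add: comp_intros)
  ultimately show ?thesis by blast
qed

text \<open>Any class fits into an infinite one, so it is enough to assign distinct infinite classes
  of the target, and \<open>0''\<close> decides which classes are infinite.\<close>

lemma embedding_double_jump:
  assumes C1: "computable_eq_struct U1 E1" and C2: "computable_eq_struct U2 E2"
    and inf: "infinite (inf_reps U2 E2)"
  shows "\<exists>f. computable_in zero_double_jump f \<and> embedding f U1 E1 U2 E2"
proof -
  have "dec zero_double_jump (\<lambda>z. psnd z \<in> inf_reps U2 E2)"
    using dec_subst[OF dec_not[OF dec_double_jump_Sig2[OF Pi2_inf_reps[OF C2]]] comp_psnd0] by simp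
  then obtain t where t: "computable_in zero_double_jump t" "strict_mono t" "\<And>n. t n \<in> inf_reps U2 E2"
    using increasing_choice[of _ "\<lambda>n y. y \<in> inf_reps U2 E2"] inf by auto
  show ?thesis
  proof (rule embedding_of_rep_map[OF C1 C2 t(1)])
    show "\<exists>m'. cnt E1 r m \<le> cnt E2 (t r) m'" for r m
      using t(3)[of r] le_cnt_of_infinite by (auto simp: inf_reps_def)
    show "r = s" if "(t r, t s) \<in> E2" for r s
      using reps_unique[OF comp_eq_struct_equiv[OF C2] _ _ that] t(2,3)
      by (auto simp: inf_reps_def strict_mono_eq)
  qed
qed

text \<open>The set \<open>F\<close> of classes that are infinite, or such that only finitely many classes are at least as
  large, is finite, and these classes are sent along the given embedding. For every other class the
  target has infinitely many classes that are at least as large, and \<open>0'\<close> can find one of them since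
  it computes the size of a finite class.\<close>

lemma embedding_jump:
  assumes C1: "computable_eq_struct U1 E1" and C2: "computable_eq_struct U2 E2"
    and fin: "finite (inf_reps U1 E1)" and g: "embedding g U1 E1 U2 E2"
  shows "\<exists>f. computable_in (jump {}) f \<and> embedding f U1 E1 U2 E2"
proof -
  note eq1 = comp_eq_struct_equiv[OF C1] and eq2 = comp_eq_struct_equiv[OF C2]
  define large where "large r = {s \<in> reps U1 E1. infinite (E1 `` {s}) \<or> card (E1 `` {r}) \<le> card (E1 `` {s})}" for r
  define G where "G = {r \<in> reps U1 E1. finite (E1 `` {r}) \<and> finite (large r)}"
  define F where "F = inf_reps U1 E1 \<union> G"
  define N where "N = reps U1 E1 - F"
  \<comment> \<open>All members of \<open>G\<close> are at least as large as a smallest one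
    \<open>r\<close>, so \<open>G\<close> is contained in the finite set
    \<open>large r\<close>.\<close>
  have "finite G"
  proof (cases "G = {}")
    case False
    then obtain k where "k \<in> G" by blast
    then obtain r where r: "r \<in> G" "\<And>s. s \<in> G \<Longrightarrow> card (E1 `` {r}) \<le> card (E1 `` {s})"
      using ex_has_least_nat[of "\<lambda>r. r \<in> G" k "\<lambda>r. card (E1 `` {r})"] by auto
    then have "G \<subseteq> large r" by (auto simp: G_def large_def)
    then show ?thesis using r(1) finite_subset by (auto simp: G_def)
  qed simp
  then have finF: "finite F" using fin by (simp add: F_def)
  have N: "r \<in> reps U1 E1" "finite (E1 `` {r})" "infinite (large r)" if "r \<in> N" for r
    using that by (auto simp: N_def F_def G_def inf_reps_def)
  \<comment> \<open>Targets for classes in \<open>N\<close> will be representatives above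
    \<open>M\<close>. Being the least element of its class, such a representative is not equivalent
    to any \<open>g r\<close> with \<open>r\<close> in \<open>F\<close>.\<close>
  obtain M where M: "\<And>r. r \<in> F \<Longrightarrow> g r \<le> M"
    using finF by (metis finite_imageI finite_nat_set_iff_bounded_le image_eqI)
  have decN: "dec X (\<lambda>x. x \<in> N)" for X
    unfolding N_def Diff_iff by (intro dec_conj dec_not dec_reps[OF C1] dec_finite[OF finF])
  \<comment> \<open>A strict bound for the finite class of \<open>r\<close>. Being a bound is a Pi 1
    property of the candidate, so \<open>0'\<close> finds the least one, and
    \<open>cnt E1 r (B r)\<close> is the class size.\<close>
  define B where "B r = (LEAST m. r \<notin> N \<or> \<not> (\<exists>z. m \<le> z \<and> (r, z) \<in> E1))" for r
  have exB: "\<exists>m. r \<notin> N \<or> \<not> (\<exists>z. m \<le> z \<and> (r, z) \<in> E1)" for r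
    using N(2)[of r] unfolding finite_nat_set_iff_bounded by (auto simp: not_le)
  have B: "(r, z) \<in> E1 \<Longrightarrow> z < B r" if "r \<in> N" for r z
    using LeastI_ex[OF exB[of r]] that unfolding B_def[symmetric] by (meson not_le)
  have compB: "computable_in (jump {}) B" unfolding B_def
    using exB by (intro comp_Least dec_disj dec_not dec_subst[OF decN] dec_jump_ex dec_conj dec_le
        dec_relation[OF C1] comp_intros) auto
  define D where "D r y \<longleftrightarrow> r \<notin> N \<or> (y \<in> reps U2 E2 \<and> M < y \<and> (\<exists>m. cnt E1 r (B r) \<le> cnt E2 y m))" for r y
  \<comment> \<open>\<open>dec_jump_ex\<close> needs a computable matrix, but \<open>B\<close> is
    only computable in \<open>0'\<close>; its value is therefore a free component of
    \<open>w\<close> and is substituted afterwards.\<close>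
  have "dec (jump {}) (\<lambda>w. \<exists>m. cnt E1 (pfst w) (pfst (psnd w)) \<le> cnt E2 (psnd (psnd w)) m)"
    by (intro dec_jump_ex dec_le comp_cnt[OF C1] comp_cnt[OF C2] comp_intros)
  from dec_subst[OF this, of "\<lambda>z. pair (pfst z) (pair (B (pfst z)) (psnd z))"]
  have "dec (jump {}) (\<lambda>z. \<exists>m. cnt E1 (pfst z) (B (pfst z)) \<le> cnt E2 (psnd z) m)"
    by (simp add: comp_intros comp_comp[OF compB])
  then have decD: "dec (jump {}) (\<lambda>z. D (pfst z) (psnd z))"
    unfolding D_def
    by (intro dec_disj dec_conj dec_not dec_less dec_subst[OF decN] dec_subst[OF dec_reps[OF C2]] comp_intros)
  have infD: "infinite {y. D r y}" for r
  proof (cases "r \<in> N")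
    case True
    let ?h = "\<lambda>s. rep U2 E2 (g s)"
    \<comment> \<open>A class in \<open>large r\<close> is at least as large as that of
      \<open>r\<close>, and \<open>g\<close> carries it into a class that is again large enough;
      infinitely many of these have a representative above \<open>M\<close>.\<close>
    have "D r (?h s)" if s: "s \<in> large r" "M < ?h s" for s
    proof -
      have sU: "s \<in> U1" using s(1) reps_subset by (auto simp: large_def)
      then have gs: "g s \<in> U2" using g by (auto simp: embedding_def)
      have "cnt E1 r (B r) \<le> card (E1 `` {r})"
        unfolding cnt_def using N(2)[OF True] by (intro card_mono) auto
      moreover have "\<exists>m. card (E1 `` {r}) \<le> cnt E1 s m"
      proof (cases "finite (E1 `` {s})")
        case True
        then have "card (E1 `` {r}) \<le> card (E1 `` {s})" using s(1) by (simp add: large_def)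
        then show ?thesis using card_le_cnt[OF True subset_refl] order_trans by blast
      qed (rule le_cnt_of_infinite)
      ultimately have "\<exists>m. cnt E1 r (B r) \<le> cnt E1 s m" using order_trans by blast
      then have "\<exists>m. cnt E1 r (B r) \<le> cnt E2 (g s) m"
        using cnt_le_embedding[OF g eq1 sU] order_trans by blast
      then have "\<exists>m. cnt E1 r (B r) \<le> cnt E2 (?h s) m"
        using cnt_class_cong[OF eq2 rep_related[OF eq2 gs]] by simp
      then show ?thesis unfolding D_def using rep_in_reps[OF eq2 gs] s(2) by blast
    qed
    then have "?h ` large r - {..M} \<subseteq> {y. D r y}" by auto
    moreover have "inj_on ?h (large r)"
      by (rule inj_on_subset[OF inj_on_rep_embedding[OF g eq1 eq2]]) (auto simp: large_def)
    then have "infinite (?h ` large r)" using N(3)[OF True] finite_imageD by blast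
    then have "infinite (?h ` large r - {..M})" by simp
    ultimately show ?thesis using finite_subset by blast
  qed (simp add: D_def)
  obtain t0 where t0: "computable_in (jump {}) t0" "strict_mono t0" "\<And>n. D n (t0 n)"
    using increasing_choice[OF decD infD] by blast
  define t where "t r = (if r \<in> F then g r else t0 r)" for r
  have t: "computable_in (jump {}) t"
    unfolding t_def by (rule comp_fun_upd_finite[OF t0(1) finF])
  have FN: "r \<in> F \<or> r \<in> N" if "r \<in> reps U1 E1" for r using that by (auto simp: N_def)
  have sepFN: "(g r, t0 s) \<notin> E2" if "r \<in> F" "s \<in> N" for r s
  proof -
    have "t0 s \<in> reps U2 E2" "g r < t0 s"
      using t0(3)[of s] M[OF that(1)] that(2) by (auto simp: D_def)
    then show ?thesis by (auto simp: reps_def)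
  qed
  show ?thesis
  proof (rule embedding_of_rep_map[OF C1 C2 t])
    fix r m assume r: "r \<in> reps U1 E1"
    show "\<exists>m'. cnt E1 r m \<le> cnt E2 (t r) m'"
    proof (cases "r \<in> F")
      case True
      then show ?thesis using cnt_le_embedding[OF g eq1 subsetD[OF reps_subset r]] by (simp add: t_def)
    next
      case False
      then have rN: "r \<in> N" using FN r by blast
      have "cnt E1 r m \<le> cnt E1 r (B r)"
        unfolding cnt_def using B[OF rN] by (intro card_mono finite_less_conj) auto
      then show ?thesis using t0(3)[of r] rN False order_trans unfolding D_def t_def by auto
    qed
  next
    fix r s assume r: "r \<in> reps U1 E1" and s: "s \<in> reps U1 E1" and E: "(t r, t s) \<in> E2"
    show "r = s"
    proof (cases "r \<in> F \<longleftrightarrow> s \<in> F")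
      case True
      show ?thesis
      proof (cases "r \<in> F")
        case True
        then have "(g r, g s) \<in> E2" using E \<open>r \<in> F \<longleftrightarrow> s \<in> F\<close> by (simp add: t_def)
        then have "(r, s) \<in> E1" using g r s reps_subset unfolding embedding_def by blast
        then show ?thesis using reps_unique[OF eq1 r s] by blast
      next
        case False
        then have "r \<in> N" "s \<in> N" "(t0 r, t0 s) \<in> E2"
          using E FN r s \<open>r \<in> F \<longleftrightarrow> s \<in> F\<close> by (auto simp: t_def)
        then have "t0 r = t0 s" using reps_unique[OF eq2] t0(3) by (metis D_def)
        then show ?thesis using t0(2) by (simp add: strict_mono_eq)
      qed
    next
      case False
      then show ?thesis using E FN r s sepFN equiv_symD[OF eq2 E] by (auto simp: t_def split: if_splits)
    qed
  qed
qed

section \<open>Structures with prescribed infinite classes\<close>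

text \<open>An element \<open>u\<close> codes \<open>(k, c, d)\<close> and is good if \<open>d\<close> is the least bound for witnesses of
  \<open>\<forall>c'\<le>c. \<exists>d'. R ((p, k), (c', d'))\<close>. So there are infinitely many good elements with key \<open>k\<close> iff
  \<open>\<forall>c. \<exists>d. R ((p, k), (c, d))\<close>.\<close>

definition bounded_wit :: "(nat \<Rightarrow> bool) \<Rightarrow> nat \<Rightarrow> nat \<Rightarrow> nat \<Rightarrow> bool" where
  "bounded_wit R q c d \<longleftrightarrow> (\<forall>c'<Suc c. \<exists>d'<Suc d. R (pair q (pair c' d')))"

definition good :: "(nat \<Rightarrow> bool) \<Rightarrow> nat \<Rightarrow> nat \<Rightarrow> bool" where
  "good R p u \<longleftrightarrow> bounded_wit R (pair p (pfst u)) (pfst (psnd u)) (psnd (psnd u)) \<and>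
     (\<forall>e<psnd (psnd u). \<not> bounded_wit R (pair p (pfst u)) (pfst (psnd u)) e)"

text \<open>Elements that are not good form singleton classes, so an infinite class always belongs
  to a key. The parameter \<open>p\<close> makes this a uniformly computable family.\<close>

definition key_rel :: "(nat \<Rightarrow> bool) \<Rightarrow> nat \<Rightarrow> (nat \<times> nat) set" where
  "key_rel R p = {(u, v). u = v \<or> (good R p u \<and> good R p v \<and> pfst u = pfst v)}"

lemma equiv_key_rel: "equiv UNIV (key_rel R p)"
  by (intro equivI refl_onI symI transI) (auto simp: key_rel_def)

lemma dec_key_rel:
  assumes "dec {} R"
  shows "dec {} (\<lambda>z. (pfst (psnd z), psnd (psnd z)) \<in> key_rel R (pfst z))"
  unfolding key_rel_def good_def bounded_wit_def mem_Collect_eq prod.case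
  by (intro dec_intros dec_subst[OF assms] comp_intros)

text \<open>\<open>d\<close> is determined as a least bound, so the good elements with a given key
  are counted by their component \<open>c\<close>.\<close>

lemma good_inj:
  "good R p u \<Longrightarrow> good R p v \<Longrightarrow> pfst u = pfst v \<Longrightarrow> pfst (psnd u) = pfst (psnd v) \<Longrightarrow> u = v"
proof -
  assume *: "good R p u" "good R p v" "pfst u = pfst v" "pfst (psnd u) = pfst (psnd v)"
  then have "\<not> psnd (psnd u) < psnd (psnd v)" "\<not> psnd (psnd v) < psnd (psnd u)"
    unfolding good_def by metis+
  then have "psnd (psnd u) = psnd (psnd v)" by simp
  with * show "u = v" by (metis prod.collapse prod_decode_inverse)
qed

lemma good_exists:
  assumes "\<forall>c. \<exists>d. R (pair (pair p k) (pair c d))"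
  shows "\<exists>d. good R p (pair k (pair c d))"
proof -
  have "\<exists>d. bounded_wit R (pair p k) c d"
  proof (induction c)
    case 0
    then show ?case using assms[rule_format, of 0] by (auto simp: bounded_wit_def)
  next
    case (Suc c)
    then obtain d where d: "bounded_wit R (pair p k) c d" by blast
    obtain e where e: "R (pair (pair p k) (pair (Suc c) e))" using assms by blast
    have "bounded_wit R (pair p k) (Suc c) (d + e)" unfolding bounded_wit_def
    proof (intro allI impI)
      fix c' assume "c' < Suc (Suc c)"
      then consider "c' < Suc c" | "c' = Suc c" by linarith
      then show "\<exists>d'<Suc (d + e). R (pair (pair p k) (pair c' d'))"
      proof cases
        case 1
        then obtain d' where "d' < Suc d" "R (pair (pair p k) (pair c' d'))"
          using d unfolding bounded_wit_def by blast
        then show ?thesis by (intro exI[of _ d']) simp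
      next
        case 2
        then show ?thesis using e by (intro exI[of _ e]) simp
      qed
    qed
    then show ?case by blast
  qed
  then obtain d where "bounded_wit R (pair p k) c d" "\<And>e. e < d \<Longrightarrow> \<not> bounded_wit R (pair p k) c e"
    using exists_least_iff[of "bounded_wit R (pair p k) c"] by blast
  then show ?thesis by (intro exI[of _ d]) (simp add: good_def)
qed

lemma infinite_good_iff:
  "infinite {v. good R p v \<and> pfst v = k} \<longleftrightarrow> (\<forall>c. \<exists>d. R (pair (pair p k) (pair c d)))"
proof
  let ?V = "{v. good R p v \<and> pfst v = k}"
  assume "infinite ?V"
  moreover have "inj_on (\<lambda>v. pfst (psnd v)) ?V"
    by (rule inj_onI, rule good_inj[of R p]) simp_all
  ultimately have inf: "infinite ((\<lambda>v. pfst (psnd v)) ` ?V)" using finite_imageD by blast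
  show "\<forall>c. \<exists>d. R (pair (pair p k) (pair c d))"
  proof
    fix c
    obtain v where "v \<in> ?V" "c < pfst (psnd v)"
      using inf unfolding infinite_nat_iff_unbounded by blast
    then have "bounded_wit R (pair p k) (pfst (psnd v)) (psnd (psnd v))" "c < Suc (pfst (psnd v))"
      by (auto simp: good_def)
    then show "\<exists>d. R (pair (pair p k) (pair c d))" unfolding bounded_wit_def by blast
  qed
next
  let ?V = "{v. good R p v \<and> pfst v = k}"
  assume *: "\<forall>c. \<exists>d. R (pair (pair p k) (pair c d))"
  have "c \<in> (\<lambda>v. pfst (psnd v)) ` ?V" for c
  proof -
    obtain d where "good R p (pair k (pair c d))" using good_exists[OF *] by blast
    then show ?thesis by (intro image_eqI[of _ _ "pair k (pair c d)"]) auto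
  qed
  then have "UNIV = (\<lambda>v. pfst (psnd v)) ` ?V" by (rule UNIV_eq_I)
  then show "infinite ?V"
    using infinite_UNIV_nat finite_imageI[of ?V "\<lambda>v. pfst (psnd v)"] by auto
qed

lemma infinite_key_rel_class_iff:
  "infinite (key_rel R p `` {u}) \<longleftrightarrow>
     good R p u \<and> (\<forall>c. \<exists>d. R (pair (pair p (pfst u)) (pair c d)))"
proof (cases "good R p u")
  case True
  then have "key_rel R p `` {u} = {v. good R p v \<and> pfst v = pfst u}" by (auto simp: key_rel_def)
  then show ?thesis using True infinite_good_iff by simp
next
  case False
  then have "key_rel R p `` {u} = {u}" by (auto simp: key_rel_def)
  then show ?thesis using False by simp
qed

text \<open>\<open>pfst\<close> maps the representatives of infinite classes bijectively onto the
  keys with the property.\<close>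

lemma infinite_inf_reps_key_rel_iff:
  "infinite (inf_reps UNIV (key_rel R p)) \<longleftrightarrow>
     infinite {k. \<forall>c. \<exists>d. R (pair (pair p k) (pair c d))}"
proof -
  have "inj_on pfst (inf_reps UNIV (key_rel R p))"
  proof (rule inj_onI)
    fix u v assume u: "u \<in> inf_reps UNIV (key_rel R p)" and v: "v \<in> inf_reps UNIV (key_rel R p)"
      and "pfst u = pfst v"
    then have "(u, v) \<in> key_rel R p"
      unfolding inf_reps_def infinite_key_rel_class_iff by (auto simp: key_rel_def)
    then show "u = v" using u v reps_unique[OF equiv_key_rel] by (auto simp: inf_reps_def)
  qed
  moreover have "pfst ` inf_reps UNIV (key_rel R p) = {k. \<forall>c. \<exists>d. R (pair (pair p k) (pair c d))}"
  proof (intro set_eqI iffI)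
    fix k assume "k \<in> {k. \<forall>c. \<exists>d. R (pair (pair p k) (pair c d))}"
    then have k: "\<forall>c. \<exists>d. R (pair (pair p k) (pair c d))" by simp
    obtain d where d: "good R p (pair k (pair 0 d))" using good_exists[OF k] by blast
    let ?r = "rep UNIV (key_rel R p) (pair k (pair 0 d))"
    have "(?r, pair k (pair 0 d)) \<in> key_rel R p" by (rule rep_related[OF equiv_key_rel]) simp
    then have r: "good R p ?r" "pfst ?r = k" using d by (auto simp: key_rel_def)
    then have "?r \<in> inf_reps UNIV (key_rel R p)"
      unfolding inf_reps_def mem_Collect_eq infinite_key_rel_class_iff
      using k rep_in_reps[OF equiv_key_rel] by simp
    then show "k \<in> pfst ` inf_reps UNIV (key_rel R p)" using r(2) by force
  qed (auto simp: inf_reps_def infinite_key_rel_class_iff)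
  ultimately show ?thesis by (metis finite_image_iff)
qed

section \<open>Keys that code initial segments of a sequence of witnesses\<close>

definition seq_keys :: "(nat \<Rightarrow> nat \<Rightarrow> bool) \<Rightarrow> nat set" where
  "seq_keys V = {k. tlc (psnd k) (pfst k) = 0 \<and> (\<forall>i<pfst k. V i (nthc (psnd k) i))}"

lemma inj_on_pfst_seq_keys:
  assumes "\<And>i u v. V i u \<Longrightarrow> V i v \<Longrightarrow> u = v"
  shows "inj_on pfst (seq_keys V)"
proof (rule inj_onI)
  fix k l assume kl: "k \<in> seq_keys V" "l \<in> seq_keys V" and eq: "pfst k = pfst l"
  have "psnd k = psnd l"
  proof (rule nthc_unique[of _ "pfst k"])
    show "nthc (psnd k) i = nthc (psnd l) i" if "i < pfst k" for i
      using kl eq that by (intro assms[of i]) (simp_all add: seq_keys_def)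
  qed (use kl eq in \<open>simp_all add: seq_keys_def\<close>)
  with eq show "k = l" by (metis prod.collapse prod_decode_inverse)
qed

text \<open>Uniqueness of values leaves at most one key of each length, so infinitely many keys have
  unbounded lengths and every \<open>i\<close> is covered. Conversely, a full sequence has
  infinitely many initial segments.\<close>

lemma infinite_seq_keys_iff:
  assumes "\<And>i u v. V i u \<Longrightarrow> V i v \<Longrightarrow> u = v"
  shows "infinite (seq_keys V) \<longleftrightarrow> (\<forall>i. \<exists>u. V i u)"
proof
  assume "infinite (seq_keys V)"
  then have inf: "infinite (pfst ` seq_keys V)"
    using inj_on_pfst_seq_keys[of V] assms finite_imageD by blast
  show "\<forall>i. \<exists>u. V i u"
  proof
    fix i
    obtain k where "k \<in> seq_keys V" "i < pfst k"
      using inf unfolding infinite_nat_iff_unbounded by blast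
    then show "\<exists>u. V i u" by (auto simp: seq_keys_def)
  qed
next
  assume "\<forall>i. \<exists>u. V i u"
  then obtain F where F: "\<And>i. V i (F i)" by metis
  have "n \<in> pfst ` seq_keys V" for n
  proof -
    obtain w where "tlc w n = 0" "\<forall>i<n. nthc w i = F i" using nthc_exists by blast
    then show ?thesis
      using F by (intro image_eqI[of _ _ "pair n w"]) (auto simp: seq_keys_def)
  qed
  then have "UNIV = pfst ` seq_keys V" by (rule UNIV_eq_I)
  then show "infinite (seq_keys V)" using finite_imageI infinite_UNIV_nat by metis
qed

text \<open>The witnesses sit inside the key, so checking it adds only a bounded quantifier and the
  level does not rise.\<close>

lemma Pi_seq_keys:
  assumes "Pi n (\<lambda>z. V (pfst z) (pfst (psnd z)) (psnd (psnd z)))"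
  shows "Pi n (\<lambda>z. psnd z \<in> seq_keys (V (pfst z)))"
proof -
  have V: "Pi n (\<lambda>z. V (pfst (pfst z)) (psnd z) (nthc (psnd (psnd (pfst z))) (psnd z)))"
    using Sig_subst[OF assms, of "\<lambda>z. pair (pfst (pfst z)) (pair (psnd z) (nthc (psnd (psnd (pfst z))) (psnd z)))"]
    by (simp add: comp_intros comp_nthc)
  show ?thesis
    unfolding seq_keys_def mem_Collect_eq
    by (intro Pi_conj Pi_ball V Pi_dec[OF dec_eq] comp_tlc comp_intros)
qed

lemma key_rel_of_Pi2:
  assumes "Pi (Suc (Suc 0)) (\<lambda>z. Q (pfst z) (psnd z))"
  obtains R where "dec {} R" "\<And>p k. Q p k \<longleftrightarrow> (\<forall>c. \<exists>d. R (pair (pair p k) (pair c d)))"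
proof -
  have "Pi 2 (\<lambda>z. Q (pfst z) (psnd z))" using assms by (simp add: numeral_2_eq_2)
  then obtain R where "dec {} R" "\<And>x. Q (pfst x) (psnd x) \<longleftrightarrow> (\<forall>c. \<exists>d. R (pair x (pair c d)))"
    by (rule Pi2_normal_form) blast
  from that[OF this(1)] this(2)[of "pair _ _"] show ?thesis by simp
qed

lemma computable_key_rel: "dec {} R \<Longrightarrow> computable_eq_struct UNIV (key_rel R p)"
proof -
  assume R: "dec {} R"
  have "dec {} (\<lambda>z. (pfst z, psnd z) \<in> key_rel R p)"
    using dec_subst[OF dec_key_rel[OF R], of "\<lambda>z. pair p z"] by (simp add: comp_intros)
  moreover have "z \<in> {prod_encode (x, y) | x y. (x, y) \<in> key_rel R p} \<longleftrightarrow> (pfst z, psnd z) \<in> key_rel R p" for z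
    by (auto, metis prod.collapse prod_decode_inverse)
  ultimately show ?thesis
    unfolding computable_eq_struct_def computable_set_iff_dec by (simp add: equiv_key_rel dec_const)
qed

section \<open>The degree of bi-embeddable categoricity\<close>

lemma bi_embeddable_inf_reps_iff:
  assumes "equiv U1 E1" "equiv U E" "bi_embeddable U1 E1 U E"
  shows "infinite (inf_reps U1 E1) \<longleftrightarrow> infinite (inf_reps U E)"
  using assms infinite_inf_reps_embedding unfolding bi_embeddable_def embeds_def by blast

lemma bec_computes_double_jump:
  assumes "equiv U E" "infinite (inf_reps U E)"
  shows "bec_computes zero_double_jump U E"
  unfolding bec_computes_def
  using assms bi_embeddable_inf_reps_iff[OF comp_eq_struct_equiv assms(1)] embedding_double_jump by blast

lemma bec_computes_jump:
  assumes "equiv U E" "finite (inf_reps U E)"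
  shows "bec_computes (jump {}) U E"
  unfolding bec_computes_def
proof (intro allI impI, elim conjE)
  fix U1 E1 U2 E2
  assume C1: "computable_eq_struct U1 E1" and C2: "computable_eq_struct U2 E2"
    and b1: "bi_embeddable U1 E1 U E" and b2: "bi_embeddable U2 E2 U E"
  have fin: "finite (inf_reps U1 E1)" "finite (inf_reps U2 E2)"
    using bi_embeddable_inf_reps_iff[OF comp_eq_struct_equiv assms(1)] C1 C2 b1 b2 assms(2) by blast+
  have "embeds U1 E1 U2 E2" "embeds U2 E2 U1 E1"
    using b1 b2 embeds_trans unfolding bi_embeddable_def by blast+
  then show "(\<exists>f. computable_in (jump {}) f \<and> embedding f U1 E1 U2 E2) \<and>
      (\<exists>g. computable_in (jump {}) g \<and> embedding g U2 E2 U1 E1)"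
    using embedding_jump C1 C2 fin unfolding embeds_def by metis
qed

text \<open>Keys \<open>(n, w)\<close> with infinite class describe \<open>0''\<close> below \<open>n\<close> correctly: \<open>w\<^sub>e\<close> is \<open>0\<close> if \<open>e\<close> is not in
  \<open>0''\<close>, and otherwise \<open>b + 1\<close> for the least witness \<open>b\<close>. Since there is only one such key for each \<open>n\<close>,
  infinitely many of them describe all of \<open>0''\<close>.\<close>

lemma double_jump_turing_le:
  assumes C: "computable_eq_struct U E" and inf: "infinite (inf_reps U E)" and Y: "bec_computes Y U E"
  shows "zero_double_jump \<le>\<^sub>T Y"
proof -
  obtain S where S: "Sig (Suc 0) (\<lambda>z. \<not> S z)"
    and "(\<lambda>x. x \<in> zero_double_jump) = (\<lambda>x. \<exists>y. S (pair x y))"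
    using Sig2_double_jump by (rule Sig_SucE)
  then have J: "e \<in> zero_double_jump \<longleftrightarrow> (\<exists>b. S (pair e b))" for e by metis
  define V where "V e u \<longleftrightarrow> (u = 0 \<and> e \<notin> zero_double_jump) \<or>
      (0 < u \<and> S (pair e (u - 1)) \<and> (\<forall>b<u - 1. \<not> S (pair e b)))" for e u
  have uniq: "u = v" if "V e u" "V e v" for e u v
  proof -
    have "\<not> u - 1 < v - 1" "\<not> v - 1 < u - 1" "u = 0 \<longleftrightarrow> v = 0" using that unfolding V_def J by auto
    then show ?thesis by linarith
  qed
  have ex: "\<exists>u. V e u" for e
  proof (cases "e \<in> zero_double_jump")
    case True
    then have "S (pair e (LEAST b. S (pair e b)))" unfolding J by (rule LeastI_ex)
    then have "V e (Suc (LEAST b. S (pair e b)))" unfolding V_def by (auto dest: not_less_Least)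
    then show ?thesis by blast
  qed (auto simp: V_def)
  \<comment> \<open>The case \<open>u = 0\<close> is Pi 2 as \<open>0''\<close> is Sigma 2. In the
    other case \<open>S\<close> is Pi 1, and its negations for smaller candidates are Sigma 1; both
    are also Pi 2.\<close>
  have "Pi (Suc (Suc 0)) (\<lambda>z. V (pfst z) (psnd z))" unfolding V_def
    by (intro Pi_disj Pi_conj Pi_ball Pi_dec[OF dec_eq] Pi_dec[OF dec_less]
        Pi_Suc[OF Sig_subst[OF S]] Pi_of_Sig[OF Sig_subst[OF S]]
        Pi_not[OF Sig_subst[OF Sig2_double_jump]] comp_intros)
  then have "Pi (Suc (Suc 0)) (\<lambda>z. V (pfst (psnd z)) (psnd (psnd z)))"
    using Sig_subst[of _ "\<lambda>z. \<not> V (pfst z) (psnd z)" psnd] comp_psnd0 by simp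
  then have "Pi (Suc (Suc 0)) (\<lambda>z. psnd z \<in> seq_keys V)" by (rule Pi_seq_keys)
  then obtain R where R: "dec {} R"
    "\<And>p k. k \<in> seq_keys V \<longleftrightarrow> (\<forall>c. \<exists>d. R (pair (pair p k) (pair c d)))"
    by (rule key_rel_of_Pi2) blast
  \<comment> \<open>In \<open>?A\<close> every key \<open>n\<close> has an infinite class with the
    known member \<open>(n, (0, 0))\<close>, while the infinite classes of \<open>?B\<close> are
    those with correct keys. Hence any embedding of \<open>?A\<close> into \<open>?B\<close> points
    to correct keys.\<close>
  let ?A = "key_rel (\<lambda>_. True) 0" and ?B = "key_rel R 0"
  have CA: "computable_eq_struct UNIV ?A" by (intro computable_key_rel dec_const)
  have CB: "computable_eq_struct UNIV ?B" by (intro computable_key_rel R(1))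
  have infA: "infinite (inf_reps UNIV ?A)" unfolding infinite_inf_reps_key_rel_iff by simp
  have infB: "infinite (inf_reps UNIV ?B)"
    unfolding infinite_inf_reps_key_rel_iff R(2)[of _ 0, symmetric] Collect_mem_eq
    using infinite_seq_keys_iff[of V] uniq ex by blast
  have "bi_embeddable UNIV ?A U E" "bi_embeddable UNIV ?B U E"
    unfolding bi_embeddable_def embeds_def
    using embedding_double_jump CA CB C infA infB inf by blast+
  then obtain f where f: "computable_in Y f" "embedding f UNIV ?A UNIV ?B"
    using Y CA CB unfolding bec_computes_def by blast
  define z where "z n = f (pair n (pair 0 0))" for n
  have good0: "good (\<lambda>_. True) 0 (pair n (pair c 0))" for n c
    by (auto simp: good_def bounded_wit_def)
  have "infinite (?B `` {z n})" for n
  proof -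
    have "infinite (?A `` {pair n (pair 0 0)})" unfolding infinite_key_rel_class_iff using good0 by simp
    then have "infinite (f ` (?A `` {pair n (pair 0 0)}))"
      using f(2) finite_imageD inj_on_subset unfolding embedding_def by blast
    moreover have "f ` (?A `` {pair n (pair 0 0)}) \<subseteq> ?B `` {z n}"
      using f(2) by (auto simp: embedding_def z_def)
    ultimately show ?thesis using finite_subset by blast
  qed
  then have z: "good R 0 (z n)" "pfst (z n) \<in> seq_keys V" for n
    unfolding infinite_key_rel_class_iff R(2)[of _ 0, symmetric] by blast+
  have "inj (\<lambda>n. pfst (z n))"
  proof (rule injI)
    fix n m assume "pfst (z n) = pfst (z m)"
    then have "(z n, z m) \<in> ?B" using z(1) by (simp add: key_rel_def)
    then have "(pair n (pair 0 0), pair m (pair 0 0)) \<in> ?A"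
      using f(2) by (simp add: embedding_def z_def)
    then show "n = m" by (auto simp: key_rel_def)
  qed
  then have "inj (\<lambda>n. pfst (pfst (z n)))"
    using inj_on_pfst_seq_keys[of V] uniq z(2) unfolding inj_on_def by blast
  then have "infinite (range (\<lambda>n. pfst (pfst (z n))))" by (rule range_inj_infinite)
  then have unb: "\<exists>n. e < pfst (pfst (z n))" for e
    unfolding infinite_nat_iff_unbounded by blast
  \<comment> \<open>Correctness of the key of \<open>z n\<close> is guaranteed by \<open>f\<close>,
    so only its length has to be checked; lengths are unbounded because distinct correct keys differ
    in length.\<close>
  define N where "N e = (LEAST n. e < pfst (pfst (z n)))" for e
  have cz: "computable_in Y z" unfolding z_def by (intro comp_comp[OF f(1)] comp_intros)
  have cN: "computable_in Y N" unfolding N_def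
    using unb by (intro comp_Least dec_less comp_comp[OF cz] comp_intros)
  have "e < pfst (pfst (z (N e)))" for e unfolding N_def by (rule LeastI_ex[OF unb])
  then have "V e (nthc (psnd (pfst (z (N e)))) e)" for e
    using z(2)[of "N e"] by (auto simp: seq_keys_def)
  then have "e \<in> zero_double_jump \<longleftrightarrow> nthc (psnd (pfst (z (N e)))) e \<noteq> 0" for e
    unfolding V_def J by (metis less_irrefl)
  then show ?thesis unfolding turing_le_iff_dec
    by (simp only:) (intro dec_not dec_eq comp_nthc comp_comp[OF cz] comp_comp[OF cN] cN comp_intros)
qed

theorem has_bec_degree_double_jump_iff:
  assumes "computable_eq_struct U E"
  shows "has_bec_degree U E zero_double_jump \<longleftrightarrow> infinite (inf_reps U E)"
proof
  note eq = comp_eq_struct_equiv[OF assms]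
  show "has_bec_degree U E zero_double_jump" if "infinite (inf_reps U E)"
    unfolding has_bec_degree_def
    using bec_computes_double_jump[OF eq that] double_jump_turing_le[OF assms that] by blast
  show "infinite (inf_reps U E)" if "has_bec_degree U E zero_double_jump"
    using that bec_computes_jump[OF eq] not_jump_turing_le
    unfolding has_bec_degree_def zero_double_jump_def by blast
qed

section \<open>Complexity of the index set\<close>

lemma computable_C_rel: "C_is_comp_eq e \<Longrightarrow> computable_eq_struct UNIV (C_rel e)"
proof -
  assume C: "C_is_comp_eq e"
  have "\<exists>v. ev {} (prog e) z v" for z
    using C unfolding C_is_comp_eq_def by (metis prod.collapse prod_decode_inverse)
  then obtain f where f: "\<And>z. ev {} (prog e) z (f z)" by metis
  then have "computable_in {} f" unfolding computable_in_def by blast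
  then have "dec {} (\<lambda>z. f z = 1)" by (intro dec_eq comp_const)
  moreover have "f z = 1 \<longleftrightarrow> z \<in> {prod_encode (x, y) | x y. (x, y) \<in> C_rel e}" for z
    unfolding C_rel_def using f ev_deterministic
    by (simp, metis prod.collapse prod_decode_inverse)
  ultimately show ?thesis
    using C unfolding computable_eq_struct_def computable_set_iff_dec C_is_comp_eq_def
    by (simp add: dec_const)
qed

lemma Sig1_C_rel:
  assumes "computable_in {} e" "computable_in {} f" "computable_in {} g"
  shows "Sig (Suc 0) (\<lambda>x. (f x, g x) \<in> C_rel (e x))"
  using Sig_subst[OF Sig1_ev, of "\<lambda>x. pair (e x) (pair (pair (f x) (g x)) 1)"] assms
  unfolding C_rel_def by (simp add: comp_intros)

text \<open>For an arbitrary index \<open>prog e\<close> may be partial, so \<open>C_rel e\<close>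
  is only Sigma 1 and all estimates start from that. The prefix
  \<open>\<forall>k. \<exists>m\<close> then governs a Pi 2 condition: \<open>m\<close> is least in
  its class and the class is infinite.\<close>

lemma Pi04_index_set: "Pi04 {e. C_is_comp_eq e \<and> infinite (inf_reps UNIV (C_rel e))}"
proof -
  note C1 = Sig1_C_rel and C2 = Sig_Suc[OF Sig1_C_rel] Pi_of_Sig[OF Sig1_C_rel]
  have "Sig (Suc 0) (\<lambda>z. ev {} (prog (pfst (pfst (pfst z)))) (pair (psnd (pfst (pfst z))) (psnd (pfst z))) (psnd z))"
    using Sig_subst[OF Sig1_ev, of "\<lambda>z. pair (pfst (pfst (pfst z))) (pair (pair (psnd (pfst (pfst z))) (psnd (pfst z))) (psnd z))"]
    by (simp add: comp_intros)
  then have total: "Pi (Suc (Suc 0)) (\<lambda>e. \<forall>x y. \<exists>v. ev {} (prog e) (pair x y) v)"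
    by (intro Pi_all Pi_of_Sig Sig_ex) simp
  have eq: "equiv UNIV E \<longleftrightarrow> (\<forall>x. (x, x) \<in> E) \<and> (\<forall>x y. (x, y) \<in> E \<longrightarrow> (y, x) \<in> E) \<and>
      (\<forall>x y z. (x, y) \<in> E \<and> (y, z) \<in> E \<longrightarrow> (x, z) \<in> E)" for E :: "(nat \<times> nat) set"
  proof
    assume E: "equiv UNIV E"
    show "(\<forall>x. (x, x) \<in> E) \<and> (\<forall>x y. (x, y) \<in> E \<longrightarrow> (y, x) \<in> E) \<and>
      (\<forall>x y z. (x, y) \<in> E \<and> (y, z) \<in> E \<longrightarrow> (x, z) \<in> E)"
      by (intro conjI allI impI equiv_reflD[OF E] UNIV_I) (auto intro: equiv_symD[OF E] elim: equiv_transD[OF E])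
  next
    assume E: "(\<forall>x. (x, x) \<in> E) \<and> (\<forall>x y. (x, y) \<in> E \<longrightarrow> (y, x) \<in> E) \<and>
      (\<forall>x y z. (x, y) \<in> E \<and> (y, z) \<in> E \<longrightarrow> (x, z) \<in> E)"
    have r: "\<forall>x. (x, x) \<in> E" using E by (rule conjunct1)
    have s: "\<forall>x y. (x, y) \<in> E \<longrightarrow> (y, x) \<in> E" using E[THEN conjunct2] by (rule conjunct1)
    have t: "\<forall>x y z. (x, y) \<in> E \<and> (y, z) \<in> E \<longrightarrow> (x, z) \<in> E" using E[THEN conjunct2] by (rule conjunct2)
    show "equiv UNIV E"
    proof (rule equivI)
      show "refl E" using r by (simp add: refl_on_def)
      show "sym E" unfolding sym_def by (rule s)
      show "trans E" unfolding trans_def using t by blast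
    qed simp
  qed
  have comp_eq: "Pi (Suc (Suc 0)) C_is_comp_eq"
    unfolding C_is_comp_eq_def eq
    by (intro Pi_conj total Pi_all Pi_imp Sig_conj C2 comp_intros)
  have inf: "infinite (inf_reps UNIV E) \<longleftrightarrow>
      (\<forall>k. \<exists>m. k < m \<and> (\<forall>u<m. (u, m) \<notin> E) \<and> (\<forall>j. \<exists>z. j < z \<and> (m, z) \<in> E))" for E :: "(nat \<times> nat) set"
    unfolding infinite_nat_iff_unbounded[of "inf_reps UNIV E"]
    unfolding inf_reps_def reps_def infinite_nat_iff_unbounded by auto
  have "Pi (Suc (Suc (Suc (Suc 0)))) (\<lambda>e. infinite (inf_reps UNIV (C_rel e)))"
    unfolding inf
    by (intro Pi_all_Sig Sig_ex_Pi Pi_conj Pi_ball Pi_dec[OF dec_less] Pi_all_Sig[OF Sig_ex]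
        Sig_conj C1 Sig_dec[OF dec_less] comp_intros
        Pi_not[OF Sig_Suc[OF Sig1_C_rel]])
  moreover have "4 = Suc (Suc (Suc (Suc 0)))" by simp
  ultimately show ?thesis unfolding Pi04_iff_Pi mem_Collect_eq
    using Pi_conj[OF Pi_Suc[OF Pi_Suc[OF comp_eq]]] by (simp only:)
qed

text \<open>For a set defined by \<open>\<forall>a. \<exists>b. \<forall>c. \<exists>d. R\<close> the keys are \<open>(n, w)\<close>, where \<open>w\<^sub>a\<close> for \<open>a < n\<close> consists of the least witness
  \<open>b\<close> and the list of the least counterexamples \<open>c\<close> for the smaller candidates. This makes \<open>w\<close> unique while
  its correctness is still a \<open>\<forall>\<exists>\<close> condition.\<close>

lemma Pi04_hard:
  assumes "Pi04 T"
  shows "T \<le>\<^sub>m {e. C_is_comp_eq e \<and> infinite (inf_reps UNIV (C_rel e))}"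
proof -
  obtain W where W: "dec {} (\<lambda>z. z \<in> W)"
    and T: "\<And>x. x \<in> T \<longleftrightarrow> (\<forall>a. \<exists>b. \<forall>c. \<exists>d. pair x (pair a (pair b (pair c d))) \<in> W)"
    using assms unfolding Pi04_def computable_set_iff_dec by blast
  define Q where "Q x a b c \<longleftrightarrow> (\<exists>d. pair x (pair a (pair b (pair c d))) \<in> W)" for x a b c
  define V where "V x a u \<longleftrightarrow> (\<forall>c. Q x a (pfst u) c) \<and> tlc (psnd u) (pfst u) = 0 \<and>
      (\<forall>b<pfst u. \<not> Q x a b (nthc (psnd u) b) \<and> (\<forall>c<nthc (psnd u) b. Q x a b c))" for x a u
  have uniq: "u = v" if "V x a u" "V x a v" for x a u v
  proof -
    \<comment> \<open>If \<open>pfst u < pfst v\<close>, the list in \<open>v\<close> records a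
      counterexample for \<open>pfst u\<close>, whereas \<open>u\<close> claims that there is
      none.\<close>
    have "\<not> pfst u < pfst v" "\<not> pfst v < pfst u" using that unfolding V_def by blast+
    then have eq: "pfst u = pfst v" by simp
    have "psnd u = psnd v"
    proof (rule nthc_unique)
      show "tlc (psnd u) (pfst u) = 0" "tlc (psnd v) (pfst u) = 0" using that eq by (auto simp: V_def)
      fix b assume "b < pfst u"
      then have "\<not> nthc (psnd u) b < nthc (psnd v) b" "\<not> nthc (psnd v) b < nthc (psnd u) b"
        using that eq unfolding V_def by metis+
      then show "nthc (psnd u) b = nthc (psnd v) b" by simp
    qed
    with eq show ?thesis by (metis prod.collapse prod_decode_inverse)
  qed
  have ex: "(\<exists>u. V x a u) \<longleftrightarrow> (\<exists>b. \<forall>c. Q x a b c)" for x a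
  proof
    assume *: "\<exists>b. \<forall>c. Q x a b c"
    define b where "b = (LEAST b. \<forall>c. Q x a b c)"
    have b: "\<forall>c. Q x a b c" unfolding b_def using * by (rule LeastI_ex)
    have "\<exists>c. \<not> Q x a b' c" if "b' < b" for b'
      using not_less_Least[OF that[unfolded b_def]] by blast
    then have c: "\<not> Q x a b' (LEAST c. \<not> Q x a b' c)" if "b' < b" for b'
      by (rule LeastI_ex[OF _]) (rule that)
    obtain w where w: "tlc w b = 0" "\<forall>i<b. nthc w i = (LEAST c. \<not> Q x a i c)"
      using nthc_exists[of b "\<lambda>i. LEAST c. \<not> Q x a i c"] by blast
    have "V x a (pair b w)" unfolding V_def using b c w by (auto dest: not_less_Least)
    then show "\<exists>u. V x a u" by blast
  qed (auto simp: V_def)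
  have SQ: "Sig (Suc 0) (\<lambda>z. Q (f z) (g z) (h z) (k z))"
    if "computable_in {} f" "computable_in {} g" "computable_in {} h" "computable_in {} k" for f g h k
    unfolding Q_def
    by (intro Sig_ex Sig_dec dec_subst[OF W] comp_intros comp_comp[OF that(1)] comp_comp[OF that(2)]
        comp_comp[OF that(3)] comp_comp[OF that(4)])
  \<comment> \<open>Saying outright that smaller candidates fail would be Sigma 2. With
    counterexamples listed in \<open>u\<close>, this takes only negated and bounded instances of the
    Sigma 1 relation \<open>Q\<close>, under a bounded quantifier.\<close>
  have "Pi (Suc (Suc 0)) (\<lambda>z. V (pfst z) (pfst (psnd z)) (psnd (psnd z)))"
    unfolding V_def
    by (intro Pi_conj Pi_all_Sig Pi_ball Pi_of_Sig[OF SQ] SQ Pi_dec[OF dec_eq]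
        Pi_not[OF Sig_Suc[OF SQ]] comp_tlc comp_nthc comp_intros)
  then have "Pi (Suc (Suc 0)) (\<lambda>z. psnd z \<in> seq_keys (V (pfst z)))" by (rule Pi_seq_keys)
  then obtain R where R: "dec {} R"
    "\<And>p k. k \<in> seq_keys (V p) \<longleftrightarrow> (\<forall>c. \<exists>d. R (pair (pair p k) (pair c d)))"
    by (rule key_rel_of_Pi2) blast
  have inf: "infinite (inf_reps UNIV (key_rel R x)) \<longleftrightarrow> x \<in> T" for x
    unfolding infinite_inf_reps_key_rel_iff R(2)[symmetric] Collect_mem_eq
    using infinite_seq_keys_iff[of "V x"] uniq by (simp add: ex T Q_def)
  \<comment> \<open>One program \<open>s\<close> decides all relations \<open>key_rel R x\<close>
    uniformly; hard-wiring \<open>x\<close> gives the index \<open>h x\<close>.\<close>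
  obtain s where s: "\<And>z. ev {} s z (if (pfst (psnd z), psnd (psnd z)) \<in> key_rel R (pfst z) then 1 else 0)"
    using dec_key_rel[OF R(1)] unfolding dec_def computable_in_def by blast
  obtain h where h: "computable_in {} h" "\<And>A x y v. ev A (prog (h x)) y v \<longleftrightarrow> ev A s (pair x y) v"
    by (rule smn[of s]) blast
  have ev: "ev {} (prog (h x)) (pair u v) w \<longleftrightarrow> w = (if (u, v) \<in> key_rel R x then 1 else 0)" for x u v w
    unfolding h(2) using s[of "pair x (pair u v)"] ev_deterministic by (auto split: if_splits)
  then have "C_rel (h x) = key_rel R x" for x unfolding C_rel_def by auto
  moreover from this have "C_is_comp_eq (h x)" for x
    unfolding C_is_comp_eq_def ev using equiv_key_rel by simp
  ultimately have "x \<in> T \<longleftrightarrow> h x \<in> {e. C_is_comp_eq e \<and> infinite (inf_reps UNIV (C_rel e))}" for x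
    using inf by simp
  then show ?thesis unfolding many_one_le_def using h(1) by blast
qed

theorem theorem4p6:
  shows "Pi04_complete {e. C_is_comp_eq e \<and> has_bec_degree UNIV (C_rel e) zero_double_jump}"
proof -
  have "{e. C_is_comp_eq e \<and> has_bec_degree UNIV (C_rel e) zero_double_jump} =
      {e. C_is_comp_eq e \<and> infinite (inf_reps UNIV (C_rel e))}"
    using has_bec_degree_double_jump_iff computable_C_rel by blast
  then show ?thesis
    unfolding Pi04_complete_def using Pi04_index_set Pi04_hard by simp
qed

end
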